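(* Let $1/2\le p<1$ be fixed, $q=1-p$, and let $F_n$ be the number of queries needed before at least one element is recovered in the Rényi process on $n$ objects with bias $p$ in which inconclusive queries are ignored. Then with high probability, as $n\to\infty$, $$F_n=\begin{cases}\log_{1/q} n-\log_{1/q}\log\log n+o(\log\log\log n), & p>q,\\[2pt] \log_2 n-\log_2\log n+o(\log\log n), & p=q.\end{cases}$$
   Context: Rényi process with bias $p$. Let $X$ be a set of $n$ objects, $A$ a set of $n$ labels and $\phi:X\to A$ a (hidden) bijection. Set $\mathcal P_0=\{X\}$. Inductively, given the partition $\mathcal P_{j-1}$ of $X$ ($j\ge1$), the $j$th query is a random set $Q_j\subseteq A$: each label is included independently with probability $p$, except that, independently for each $S\in\mathcal P_{j-1}$ with $|S|\ge 2$, the decisions for the labels of the objects of $S$ are redrawn with the same law until at least one label of $\phi(S)$ is included and at least one is not (so every non-singleton class is split nontrivially; equivalently, one conditions on this event). $\mathcal P_j$ is obtained from $\mathcal P_{j-1}$ by replacing every $S$ with $|S|\ge2$ by the two sets $S\cap\phi^{-1}(Q_j)$ and $S\setminus\phi^{-1}(Q_j)$; singletons stay. External profile: $B_{n,k}$ is the number of $x\in X$ such that $\{x\}\in\mathcal P_k$ and ($k=0$ or $\{x\}\notin\mathcal P_{k-1}$), i.e. the number of bijection elements revealed by the $k$th query. Then $F_n=\min\{k: B_{n,k}>0\}-1$. "With high probability $X_n=a_n+o(b_n)$" means that $(X_n-a_n)/b_n\to0$ in probability, i.e. for every $\varepsilon>0$, $\Pr[|X_n-a_n|>\varepsilon b_n]\to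 0$. $\log$ is the natural logarithm. *)

theory Defs
  imports "HOL-Probability.Probability"
begin

section \<open>Random queries and the partition process\<close>

definition random_subset_pmf :: "real \<Rightarrow> 'b set \<Rightarrow> 'b set pmf" where
  "random_subset_pmf p A =
     map_pmf (\<lambda>f. {a \<in> A. f a}) (Pi_pmf A False (\<lambda>_. bernoulli_pmf p))"

definition conclusive :: "('a \<Rightarrow> 'b) \<Rightarrow> 'a set set \<Rightarrow> 'b set \<Rightarrow> bool" where
  "conclusive \<phi> P R \<longleftrightarrow>
     (\<forall>S\<in>P. card S \<ge> 2 \<longrightarrow> \<phi> ` S \<inter> R \<noteq> {} \<and> \<phi> ` S - R \<noteq> {})"

text \<open>
  Redrawing the decisions on each non-singleton class independently until that class is split is
  the same as conditioning on all these classes being split, since the classes are disjoint.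
\<close>

definition query_pmf ::
  "real \<Rightarrow> 'b set \<Rightarrow> ('a \<Rightarrow> 'b) \<Rightarrow> 'a set set \<Rightarrow> 'b set pmf" where
  "query_pmf p A \<phi> P = cond_pmf (random_subset_pmf p A) {R. conclusive \<phi> P R}"

definition split_classes ::
  "('a \<Rightarrow> 'b) \<Rightarrow> 'a set set \<Rightarrow> 'b set \<Rightarrow> 'a set set" where
  "split_classes \<phi> P R =
     (\<Union>S\<in>P. if card S \<ge> 2 then {S \<inter> \<phi> -` R, S - \<phi> -` R} else {S})"

text \<open>Queries are numbered from 1; the value \<open>Q 0\<close> is never used.\<close>

primrec renyi_partition ::
  "'a set \<Rightarrow> ('a \<Rightarrow> 'b) \<Rightarrow> (nat \<Rightarrow> 'b set) \<Rightarrow> nat \<Rightarrow> 'a set set" where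
  "renyi_partition X \<phi> Q 0 = {X}"
| "renyi_partition X \<phi> Q (Suc j) =
     split_classes \<phi> (renyi_partition X \<phi> Q j) (Q (Suc j))"

definition external_profile ::
  "'a set \<Rightarrow> ('a \<Rightarrow> 'b) \<Rightarrow> (nat \<Rightarrow> 'b set) \<Rightarrow> nat \<Rightarrow> nat" where
  "external_profile X \<phi> Q k =
     card {x \<in> X. {x} \<in> renyi_partition X \<phi> Q k \<and>
                  (k = 0 \<or> {x} \<notin> renyi_partition X \<phi> Q (k - 1))}"

text \<open>Integer-valued, as the value is \<open>-1\<close> when there is only one object.\<close>

definition fillup_level ::
  "'a set \<Rightarrow> ('a \<Rightarrow> 'b) \<Rightarrow> (nat \<Rightarrow> 'b set) \<Rightarrow> int" where
  "fillup_level X \<phi> Q = int (LEAST k. external_profile X \<phi> Q k > 0) - 1"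


section \<open>The stochastic process\<close>

text \<open>
  The last assumption is the chain rule: given any history of positive probability, the
  \<open>j\<close>th query has law \<open>query_pmf\<close> for the current partition. Here \<open>r\<close> ranges over all possible
  sequences of values of the queries.
\<close>

locale renyi_process = prob_space M
  for p :: real and X :: "'a set" and A :: "'b set" and \<phi> :: "'a \<Rightarrow> 'b"
    and M :: "'w measure" and Q :: "nat \<Rightarrow> 'w \<Rightarrow> 'b set" +
  assumes bias: "0 < p" "p < 1"
    and finite_objects: "finite X"
    and bij: "bij_betw \<phi> X A"
    and query_measurable: "\<And>j. j \<ge> 1 \<Longrightarrow> random_variable (count_space (Pow A)) (Q j)"
    and query_law: "\<And>j r. j \<ge> 1 \<Longrightarrow>
      prob {w \<in> space M. \<forall>i\<in>{1..j}. Q i w = r i} =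
      prob {w \<in> space M. \<forall>i\<in>{1..<j}. Q i w = r i} *
      pmf (query_pmf p A \<phi> (renyi_partition X \<phi> r (j - 1))) (r j)"

definition whp_eq_up_to ::
  "(nat \<Rightarrow> 'w measure) \<Rightarrow> (nat \<Rightarrow> 'w \<Rightarrow> real) \<Rightarrow> (nat \<Rightarrow> real) \<Rightarrow> (nat \<Rightarrow> real) \<Rightarrow> bool" where
  "whp_eq_up_to M Y a b \<longleftrightarrow>
     (\<forall>\<epsilon>>0. (\<lambda>n. measure (M n) {w \<in> space (M n). \<bar>Y n w - a n\<bar> > \<epsilon> * b n})
        \<longlonglongrightarrow> 0)"


section \<open>Measurability\<close>

lemma renyi_partition_subset: "S \<in> renyi_partition X \<phi> Q k \<Longrightarrow> S \<subseteq> X"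
  by (induction k arbitrary: S) (auto simp: split_classes_def split: if_splits)

lemma renyi_partition_disjoint: "disjoint (renyi_partition X \<phi> Q k)"
proof (induction k)
  case (Suc k)
  show ?case
  proof (rule disjointI)
    fix a b assume "a \<in> renyi_partition X \<phi> Q (Suc k)" "b \<in> renyi_partition X \<phi> Q (Suc k)"
      and ne: "a \<noteq> b"
    then obtain S T where ST: "S \<in> renyi_partition X \<phi> Q k" "T \<in> renyi_partition X \<phi> Q k"
      and a: "a \<in> (if card S \<ge> 2 then {S \<inter> \<phi> -` Q (Suc k), S - \<phi> -` Q (Suc k)} else {S})"
      and b: "b \<in> (if card T \<ge> 2 then {T \<inter> \<phi> -` Q (Suc k), T - \<phi> -` Q (Suc k)} else {T})"
      unfolding renyi_partition.simps split_classes_def by blast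
    show "a \<inter> b = {}"
    proof (cases "S = T")
      case True
      then show ?thesis using a b ne by (auto split: if_splits)
    next
      case False
      then have "S \<inter> T = {}" using disjointD[OF Suc.IH] ST by blast
      moreover have "a \<subseteq> S" "b \<subseteq> T" using a b by (auto split: if_splits)
      ultimately show ?thesis by blast
    qed
  qed
qed simp

lemma renyi_partition_measurable:
  assumes "finite X" "countable C"
    and "\<And>j. j \<ge> 1 \<Longrightarrow> Q j \<in> measurable M (count_space C)"
  shows "(\<lambda>w. renyi_partition X \<phi> (\<lambda>j. Q j w) k) \<in> measurable M (count_space (Pow (Pow X)))"
proof (induction k)
  case (Suc k)
  have "(\<lambda>w. split_classes \<phi> (renyi_partition X \<phi> (\<lambda>j. Q j w) k) (Q (Suc k) w))
      \<in> measurable M (count_space UNIV)"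
  proof (rule measurable_compose_countable'[OF _ Suc.IH])
    show "(\<lambda>w. split_classes \<phi> P (Q (Suc k) w)) \<in> measurable M (count_space UNIV)" for P
      by (rule measurable_compose[OF assms(3)]) auto
    show "countable (Pow (Pow X))"
      using assms(1) by (intro countable_finite) simp
  qed
  then have "(\<lambda>w. renyi_partition X \<phi> (\<lambda>j. Q j w) (Suc k)) \<in> measurable M (count_space UNIV)"
    by simp
  moreover have "renyi_partition X \<phi> (\<lambda>j. Q j w) (Suc k) \<in> Pow (Pow X)" for w
    using renyi_partition_subset by blast
  ultimately show ?case
    by (rule measurable_count_space_extend[OF subset_UNIV Pi_I, rotated])
qed simp

lemma (in renyi_process) fillup_level_measurable:
  "random_variable (count_space UNIV) (\<lambda>w. fillup_level X \<phi> (\<lambda>j. Q j w))"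
proof -
  have "finite A" using bij finite_objects bij_betw_finite by blast
  then have C: "countable (Pow A)" by (intro countable_finite) simp
  have P: "(\<lambda>w. renyi_partition X \<phi> (\<lambda>j. Q j w) k) \<in> measurable M (count_space (Pow (Pow X)))" for k
    by (rule renyi_partition_measurable[OF finite_objects C query_measurable])
  have "(\<lambda>w. external_profile X \<phi> (\<lambda>j. Q j w) k) \<in> measurable M (count_space UNIV)" for k
    unfolding external_profile_def
  proof (rule measurable_compose_countable'[OF _ P[of k]])
    fix R
    show "(\<lambda>w. card {x \<in> X. {x} \<in> R \<and> (k = 0 \<or> {x} \<notin> renyi_partition X \<phi> (\<lambda>j. Q j w) (k - 1))})
       \<in> measurable M (count_space UNIV)"
      by (rule measurable_compose[OF P[of "k - 1"]]) auto
    show "countable (Pow (Pow X))"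
      using finite_objects by (intro countable_finite) simp
  qed
  note [measurable] = this
  show ?thesis unfolding fillup_level_def by measurable
qed


section \<open>Existence of the process\<close>

lemma set_random_subset_pmf:
  assumes "finite A" "0 < p" "p < 1"
  shows "set_pmf (random_subset_pmf p A) = Pow A"
proof -
  have "set_pmf (random_subset_pmf p A) = (\<lambda>f. {a \<in> A. f a}) ` PiE_dflt A False (\<lambda>_. UNIV)"
    using assms unfolding random_subset_pmf_def
    by (simp add: set_Pi_pmf comp_def)
  also have "\<dots> = Pow A"
  proof (intro equalityI subsetI)
    fix R assume "R \<in> Pow A"
    then show "R \<in> (\<lambda>f. {a \<in> A. f a}) ` PiE_dflt A False (\<lambda>_. UNIV)"
      by (intro image_eqI[where x = "\<lambda>a. a \<in> R"]) (auto simp: PiE_dflt_def)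
  qed auto
  finally show ?thesis .
qed

lemma conclusive_exists:
  assumes "disjoint P" "\<And>S. S \<in> P \<Longrightarrow> S \<subseteq> X" "inj_on \<phi> X"
  shows "\<exists>R \<subseteq> \<phi> ` X. conclusive \<phi> P R"
proof -
  define c where "c S = (SOME x. x \<in> S)" for S :: "'a set"
  have c: "c S \<in> S" if "card S \<ge> 2" for S
  proof -
    have "S \<noteq> {}" using that by auto
    then show ?thesis by (simp add: c_def some_in_eq)
  qed
  define R where "R = \<phi> ` c ` {S \<in> P. card S \<ge> 2}"
  have "R \<subseteq> \<phi> ` X" using c assms(2) by (auto simp: R_def)
  moreover have "\<phi> ` S \<inter> R \<noteq> {} \<and> \<phi> ` S - R \<noteq> {}" if S: "S \<in> P" "card S \<ge> 2" for S
  proof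
    show "\<phi> ` S \<inter> R \<noteq> {}" using S c by (auto simp: R_def)
    have "\<not> S \<subseteq> {c S}" using S(2) card_mono[of "{c S}" S] by auto
    then obtain y where y: "y \<in> S" "y \<noteq> c S" by blast
    have "\<phi> y \<notin> R"
    proof
      assume "\<phi> y \<in> R"
      then obtain T where T: "T \<in> P" "card T \<ge> 2" "\<phi> y = \<phi> (c T)" by (auto simp: R_def)
      then have "y = c T" using assms(2,3) S(1) y(1) c[of T] by (metis inj_onD subsetD)
      then have "S = T" using disjointD[OF assms(1) S(1) T(1)] y(1) c[of T] T(2) by blast
      then show False using y \<open>y = c T\<close> by simp
    qed
    then show "\<phi> ` S - R \<noteq> {}" using y(1) by blast
  qed
  ultimately show ?thesis unfolding conclusive_def by blast
qed

lemma set_query_pmf: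
  assumes "finite X" "bij_betw \<phi> X A" "0 < p" "p < 1"
  shows "set_pmf (query_pmf p A \<phi> (renyi_partition X \<phi> r k)) =
    {R. R \<subseteq> A \<and> conclusive \<phi> (renyi_partition X \<phi> r k) R}"
proof -
  have A: "\<phi> ` X = A" "inj_on \<phi> X" "finite A"
    using assms(1,2) by (auto simp: bij_betw_def)
  obtain R where "R \<subseteq> A" "conclusive \<phi> (renyi_partition X \<phi> r k) R"
    using conclusive_exists[of "renyi_partition X \<phi> r k" X \<phi>, OF renyi_partition_disjoint _ A(2)]
      renyi_partition_subset[of _ X \<phi> r k] A(1) by blast
  then show ?thesis
    unfolding query_pmf_def using set_random_subset_pmf[OF A(3) assms(3,4)]
    by (subst set_cond_pmf) auto
qed

lemma renyi_partition_cong: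
  assumes "\<And>i. 1 \<le> i \<Longrightarrow> i \<le> k \<Longrightarrow> r i = s i"
  shows "renyi_partition X \<phi> r k = renyi_partition X \<phi> s k"
  using assms by (induction k) auto

text \<open>
  The process is realised on a product space carrying one independent query for every step and
  every possible current partition.
\<close>

primrec coupled_partition ::
  "'a set \<Rightarrow> 'b set \<Rightarrow> ('a \<Rightarrow> 'b) \<Rightarrow> (nat \<times> 'a set set \<Rightarrow> 'b set) \<Rightarrow> nat \<Rightarrow> 'a set set" where
  "coupled_partition X A \<phi> w 0 = {X}"
| "coupled_partition X A \<phi> w (Suc j) =
     split_classes \<phi> (coupled_partition X A \<phi> w j) (A \<inter> w (Suc j, coupled_partition X A \<phi> w j))"

lemma renyi_process_exists:
  fixes X :: "'a set" and A :: "'b set"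
  assumes "finite X" "bij_betw \<phi> X A" "0 < p" "p < 1"
  shows "\<exists>(M :: (nat \<times> 'a set set \<Rightarrow> 'b set) measure) Q. renyi_process p X A \<phi> M Q"
proof -
  define K where "K = (\<lambda>(j :: nat, P). measure_pmf (query_pmf p A \<phi> P))"
  define M where "M = PiM (UNIV :: (nat \<times> 'a set set) set) K"
  have "prob_space (K i)" for i
    unfolding K_def by (cases i) (simp add: prob_space_measure_pmf)
  then interpret K: product_prob_space K UNIV
    by (simp add: product_prob_space_def product_prob_space_axioms_def product_sigma_finite_def
        prob_space_imp_sigma_finite)
  have K_sets: "sets (K i) = UNIV" for i unfolding K_def by (cases i) simp
  have K_meas: "measurable (K i) (count_space UNIV) = UNIV" for i
    unfolding K_def by (cases i) simp
  define T where "T w j = coupled_partition X A \<phi> w j" for w j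
  define Q where "Q j w = A \<inter> w (j, T w (j - 1))" for j w
  have T_Q: "T w k = renyi_partition X \<phi> (\<lambda>j. Q j w) k" for w k
    by (induction k) (simp_all add: T_def Q_def)
  have coord: "(\<lambda>w. w i) \<in> measurable M (count_space UNIV)" for i
  proof -
    have "(\<lambda>w. w i) \<in> measurable M (K i)"
      unfolding M_def by (rule measurable_component_singleton) simp
    then show ?thesis by (rule measurable_compose[of _ _ _ "\<lambda>x. x"]) (simp add: K_meas)
  qed
  have T_sub: "T w k \<in> Pow (Pow X)" for w k
    unfolding T_Q using renyi_partition_subset by blast
  have finA: "finite A" using assms bij_betw_finite by blast
  have Q_from_T: "Q j \<in> measurable M (count_space UNIV)"
    if "(\<lambda>w. T w (j - 1)) \<in> measurable M (count_space (Pow (Pow X)))" for j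
    unfolding Q_def
  proof (rule measurable_compose_countable'[OF _ that])
    show "(\<lambda>w. A \<inter> w (j, P)) \<in> measurable M (count_space UNIV)" for P
      by (rule measurable_compose[OF coord]) auto
    show "countable (Pow (Pow X))" using assms(1) by (intro countable_finite) simp
  qed
  have T_meas: "(\<lambda>w. T w k) \<in> measurable M (count_space (Pow (Pow X)))" for k
  proof (induction k)
    case 0
    then show ?case by (simp add: T_def)
  next
    case (Suc k)
    have "(\<lambda>w. split_classes \<phi> (T w k) (Q (Suc k) w)) \<in> measurable M (count_space UNIV)"
    proof (rule measurable_compose_countable'[OF _ Suc.IH])
      show "(\<lambda>w. split_classes \<phi> P (Q (Suc k) w)) \<in> measurable M (count_space UNIV)" for P
        by (rule measurable_compose[OF Q_from_T]) (use Suc.IH in auto)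
      show "countable (Pow (Pow X))" using assms(1) by (intro countable_finite) simp
    qed
    moreover have "T w (Suc k) = split_classes \<phi> (T w k) (Q (Suc k) w)" for w
      by (simp add: T_def Q_def)
    ultimately have "(\<lambda>w. T w (Suc k)) \<in> measurable M (count_space UNIV)" by (simp only:)
    then show ?case
      by (rule measurable_count_space_extend[OF subset_UNIV, rotated]) (rule Pi_I, rule T_sub)
  qed
  have Q_meas: "Q j \<in> measurable M (count_space (Pow A))" for j
    using Q_from_T[OF T_meas]
    by (rule measurable_count_space_extend[rotated 2]) (auto simp: Q_def)
  have law: "measure M {w \<in> space M. \<forall>i\<in>{1..<Suc k}. Q i w = r i} =
      (\<Prod>i\<in>{1..<Suc k}. pmf (query_pmf p A \<phi> (renyi_partition X \<phi> r (i - 1))) (r i))"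
    for k and r :: "nat \<Rightarrow> 'b set"
  proof (cases "\<forall>i\<in>{1..<Suc k}. r i \<subseteq> A")
    case False
    then obtain i where i: "i \<in> {1..<Suc k}" "\<not> r i \<subseteq> A" by blast
    have "{w \<in> space M. \<forall>i\<in>{1..<Suc k}. Q i w = r i} = {}"
      using i by (force simp: Q_def)
    moreover have "pmf (query_pmf p A \<phi> (renyi_partition X \<phi> r (i - 1))) (r i) = 0"
      using i(2) by (simp add: pmf_eq_0_set_pmf set_query_pmf[OF assms])
    ultimately show ?thesis using i(1) by (metis finite_atLeastLessThan measure_empty prod_zero)
  next
    case True
    define g where "g i = (i, renyi_partition X \<phi> r (i - 1))" for i
    have inj: "inj_on g {1..<Suc k}" by (auto simp: g_def inj_on_def)
    define B where "B = (\<lambda>(i, P :: 'a set set). {R. A \<inter> R = r i})"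
    have hist: "(\<forall>i\<in>{1..<Suc k}. Q i w = r i) \<longleftrightarrow> (\<forall>i\<in>{1..<Suc k}. A \<inter> w (g i) = r i)" for w
    proof (induction k)
      case (Suc k)
      have "Q (Suc k) w = A \<inter> w (g (Suc k))" if "\<forall>i\<in>{1..<Suc k}. Q i w = r i"
      proof -
        have "T w k = renyi_partition X \<phi> r k"
          unfolding T_Q by (rule renyi_partition_cong) (use that in auto)
        then show ?thesis by (simp add: Q_def g_def)
      qed
      moreover have "{1..<Suc (Suc k)} = insert (Suc k) {1..<Suc k}" by auto
      ultimately show ?case using Suc.IH by auto
    qed simp
    have "{w \<in> space M. \<forall>i\<in>{1..<Suc k}. Q i w = r i} =
        {w \<in> space M. \<forall>i\<in>g ` {1..<Suc k}. w i \<in> B i}"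
      unfolding hist by (auto simp: B_def g_def)
    then have "emeasure M {w \<in> space M. \<forall>i\<in>{1..<Suc k}. Q i w = r i} =
        (\<Prod>i\<in>g ` {1..<Suc k}. emeasure (K i) (B i))"
      unfolding M_def by (simp only:) (rule K.emeasure_PiM_Collect; simp add: K_sets)
    also have "\<dots> = (\<Prod>i\<in>{1..<Suc k}. emeasure (K (g i)) (B (g i)))"
      by (rule prod.reindex[OF inj, simplified comp_def])
    also have "\<dots> = (\<Prod>i\<in>{1..<Suc k}.
        ennreal (pmf (query_pmf p A \<phi> (renyi_partition X \<phi> r (i - 1))) (r i)))"
    proof (rule prod.cong[OF refl])
      fix i assume i: "i \<in> {1..<Suc k}"
      let ?q = "query_pmf p A \<phi> (renyi_partition X \<phi> r (i - 1))"
      have "emeasure (measure_pmf ?q) {R. A \<inter> R = r i} = emeasure (measure_pmf ?q) {r i}"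
      proof (rule emeasure_eq_AE)
        show "AE R in measure_pmf ?q. R \<in> {R. A \<inter> R = r i} \<longleftrightarrow> R \<in> {r i}"
          using True i by (intro AE_pmfI) (auto simp: set_query_pmf[OF assms])
      qed auto
      then show "emeasure (K (g i)) (B (g i)) = ennreal (pmf ?q (r i))"
        by (simp add: K_def B_def g_def emeasure_pmf_single)
    qed
    also have "\<dots> = ennreal
        (\<Prod>i\<in>{1..<Suc k}. pmf (query_pmf p A \<phi> (renyi_partition X \<phi> r (i - 1))) (r i))"
      by (rule prod_ennreal) simp
    finally show ?thesis
      unfolding measure_def by (simp only:) (rule enn2real_ennreal, rule prod_nonneg, simp)
  qed
  have "renyi_process p X A \<phi> M Q"
  proof (intro renyi_process.intro renyi_process_axioms.intro)
    show "prob_space M" unfolding M_def by (rule K.P.prob_space_axioms)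
  next
    fix j :: nat and r :: "nat \<Rightarrow> 'b set" assume j: "j \<ge> 1"
    then have "{1..j} = {1..<Suc j}" "{1..<j} = {1..<Suc (j - 1)}" by auto
    moreover have "{1..<Suc j} = insert j {1..<j}" using j by auto
    ultimately show "measure M {w \<in> space M. \<forall>i\<in>{1..j}. Q i w = r i} =
        measure M {w \<in> space M. \<forall>i\<in>{1..<j}. Q i w = r i} *
        pmf (query_pmf p A \<phi> (renyi_partition X \<phi> r (j - 1))) (r j)"
      using law[of j r] law[of "j - 1" r] by (simp add: mult.commute)
  qed (use assms Q_meas in auto)
  then show ?thesis by blast
qed

end

theory Submission
  imports Defs "HOL-Real_Asymp.Real_Asymp"
begin

text \<open>
  Given the current partition, its classes are split independently of each other. Hence everything
  is governed by one numerical recursion: let \<open>unrevealed k m\<close> be the probability that a class of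
  \<open>m\<close> objects has produced no singleton after \<open>k\<close> rounds. A class of size \<open>m \<ge> 2\<close> is replaced by
  two classes of sizes \<open>i\<close> and \<open>m - i\<close>, where \<open>i\<close> is binomial with parameters \<open>m\<close> and \<open>q\<close>,
  conditioned on \<open>0 < i < m\<close>. By the chain rule for the queries, the Renyi process on \<open>n\<close> objects
  has no singleton after \<open>k\<close> queries with probability exactly \<open>unrevealed k n\<close>
  (\<open>prob_no_singleton\<close>), and as singletons persist, this is the event that the fillup level is at
  least \<open>k\<close>.

  The critical quantity is \<open>\<lambda> = n q\<^sup>k\<close>, the mean number of objects in none of the first \<open>k\<close>
  queries if inconclusive queries are kept. The allowed error terms let \<open>\<lambda>\<close> vary by an arbitrarily
  small power of \<open>w\<close>, where \<open>w = log log n\<close> for \<open>p > q\<close> and \<open>w = log n\<close> for \<open>p = q\<close>. So it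
  suffices to show that no singleton has appeared if \<open>\<lambda> \<ge> w\<close> to a power above \<open>1\<close>, and that one
  has appeared if \<open>\<lambda> \<le> w\<close> to a power below \<open>1\<close>.

  No singleton early: the sum of \<open>(1 - x/2)\<^sup>m\<close> over the path probabilities \<open>x\<close> of all binary words
  of length \<open>k\<close> (\<open>leaf_sum\<close>) would be transported exactly by unconditioned binomial splitting.
  Conditioning the split to be nontrivial can only decrease its mean, because \<open>x \<mapsto> (1 - x)\<^sup>m\<close> is
  convex. Therefore twice this sum bounds the probability that a singleton has appeared
  (\<open>revealed_le_leaf_sum\<close>), and the sum is at most \<open>e\<^bsup>-\<lambda>/2\<^esup> (1 + e\<^bsup>-(p/q-1)\<lambda>/2\<^esup>)\<^sup>k\<close>.

  A singleton soon: if \<open>m q\<^sup>k \<le> L\<close> with \<open>k, L \<ge> 1\<close>, a class of size \<open>m\<close> produces a singleton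
  within \<open>k\<close> rounds with probability at least \<open>q e\<^bsup>-2L\<^esup>\<close> (\<open>unrevealed_le\<close>), by comparison with
  independent thinning. This chance is met many times independently. For \<open>p > q\<close>, follow the
  classes of objects that are in none of the queries: each of them has a sibling, which gives
  about \<open>k\<close> chances, enough when \<open>L\<close> is much smaller than \<open>log k\<close> (\<open>unrevealed_le_spine\<close>). For
  \<open>p = q\<close>, all of the \<open>2\<^sup>k\<close> classes count: their sizes add up to \<open>n\<close>, so at least half of them are
  at most twice as large as the average (\<open>unrevealed_le_powr\<close>).
\<close>

section \<open>The recursion for a single class\<close>

locale split_bias =
  fixes p q :: real
  assumes p_pos: "0 < p" and q_pos: "0 < q" and p_plus_q: "p + q = 1"
begin

lemma p_lt_1: "p < 1" and q_lt_1: "q < 1"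
  using p_pos q_pos p_plus_q by auto

text \<open>
  The mean of \<open>f i\<close> when \<open>i\<close> is a binomial variable with parameters \<open>m\<close> and \<open>q\<close> conditioned on
  \<open>0 < i < m\<close>: the number of objects that a conclusive query leaves out of a class of size \<open>m\<close>.
\<close>
definition split_mean :: "nat \<Rightarrow> (nat \<Rightarrow> real) \<Rightarrow> real" where
  "split_mean m f =
     (\<Sum>i=1..<m. real (m choose i) * q ^ i * p ^ (m - i) * f i) / (1 - p ^ m - q ^ m)"

text \<open>
  The probability that a class of \<open>m \<ge> 1\<close> objects has no singleton descendant after \<open>k\<close> rounds, a
  single object counting as its own descendant. The two parts of a class evolve independently,
  whence the product.
\<close>
primrec unrevealed :: "nat \<Rightarrow> nat \<Rightarrow> real" where
  "unrevealed 0 m = (if m = 1 then 0 else 1)"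
| "unrevealed (Suc k) m =
     (if m = 1 then 0 else split_mean m (\<lambda>i. unrevealed k i * unrevealed k (m - i)))"

lemma split_prob_pos:
  assumes "2 \<le> m"
  shows "2 * p * q \<le> 1 - p ^ m - q ^ m" and "0 < 1 - p ^ m - q ^ m"
proof -
  have "p ^ m \<le> p ^ 2" "q ^ m \<le> q ^ 2"
    using assms p_pos q_pos p_lt_1 q_lt_1 by (intro power_decreasing; simp)+
  moreover have "(p + q) ^ 2 = 1" by (simp add: p_plus_q)
  ultimately show "2 * p * q \<le> 1 - p ^ m - q ^ m" by (simp add: power2_sum)
  moreover have "0 < 2 * p * q" using p_pos q_pos by simp
  ultimately show "0 < 1 - p ^ m - q ^ m" by linarith
qed

text \<open>
  Passing from conditioned to unconditioned means is how closed forms of binomial sums enter all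
  later estimates; the price is the two boundary terms.
\<close>
lemma split_mean_binomial:
  assumes "2 \<le> m"
  shows "(1 - p ^ m - q ^ m) * split_mean m f =
    (\<Sum>i\<le>m. real (m choose i) * q ^ i * p ^ (m - i) * f i) - p ^ m * f 0 - q ^ m * f m"
proof -
  have "{..m} = insert 0 (insert m {1..<m})" using assms by auto
  then have "(\<Sum>i\<le>m. real (m choose i) * q ^ i * p ^ (m - i) * f i) =
      p ^ m * f 0 + q ^ m * f m + (\<Sum>i=1..<m. real (m choose i) * q ^ i * p ^ (m - i) * f i)"
    using assms by simp
  then show ?thesis using split_prob_pos(2)[OF assms] by (simp add: split_mean_def)
qed

lemma split_mean_mono:
  assumes "2 \<le> m" "\<And>i. 1 \<le> i \<Longrightarrow> i < m \<Longrightarrow> f i \<le> g i"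
  shows "split_mean m f \<le> split_mean m g"
  unfolding split_mean_def using assms p_pos q_pos split_prob_pos(2)[OF assms(1)]
  by (intro divide_right_mono sum_mono mult_left_mono) auto

lemma split_mean_add: "split_mean m (\<lambda>i. f i + g i) = split_mean m f + split_mean m g"
  by (simp add: split_mean_def sum.distrib algebra_simps add_divide_distrib)

lemma split_mean_cmult: "split_mean m (\<lambda>i. c * f i) = c * split_mean m f"
  by (simp add: split_mean_def sum_distrib_left mult_ac)

lemma split_mean_const:
  assumes "2 \<le> m"
  shows "split_mean m (\<lambda>_. c) = c"
proof -
  have "(\<Sum>i\<le>m. real (m choose i) * q ^ i * p ^ (m - i)) = (q + p) ^ m"
    by (simp add: binomial_ring mult_ac)
  then have "(\<Sum>i\<le>m. real (m choose i) * q ^ i * p ^ (m - i) * c) = c"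
    by (simp flip: sum_distrib_right add: p_plus_q add.commute)
  then have "(1 - p ^ m - q ^ m) * split_mean m (\<lambda>_. c) = (1 - p ^ m - q ^ m) * c"
    unfolding split_mean_binomial[OF assms] by (simp only:) (simp add: algebra_simps)
  then show ?thesis using split_prob_pos(2)[OF assms] by simp
qed

lemma split_mean_diff: 
  "split_mean m (\<lambda>i. f i - g i) = split_mean m f - split_mean m g"
  using split_mean_add[of m f "\<lambda>i. - 1 * g i"] split_mean_cmult[of m "-1" g] by simp

lemma unrevealed_one [simp]: "unrevealed k (Suc 0) = 0"
  by (cases k) auto

lemma unrevealed_bounds:
  assumes "1 \<le> m"
  shows "0 \<le> unrevealed k m" and "unrevealed k m \<le> 1"
proof -
  have "0 \<le> unrevealed k m \<and> unrevealed k m \<le> 1"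
    using assms
  proof (induction k arbitrary: m)
    case (Suc k)
    show ?case
    proof (cases "m = 1")
      case False
      then have m: "2 \<le> m" using Suc.prems by simp
      have IH: "0 \<le> unrevealed k i" "unrevealed k i \<le> 1" if "1 \<le> i" for i
        using Suc.IH that by auto
      have "split_mean m (\<lambda>_. 0) \<le> split_mean m (\<lambda>i. unrevealed k i * unrevealed k (m - i))"
        using IH by (intro split_mean_mono m) simp
      moreover have "split_mean m (\<lambda>i. unrevealed k i * unrevealed k (m - i)) \<le> split_mean m (\<lambda>_. 1)"
        using IH by (intro split_mean_mono m mult_le_one) auto
      ultimately show ?thesis using False by (simp add: split_mean_const[OF m])
    qed simp
  qed simp
  then show "0 \<le> unrevealed k m" "unrevealed k m \<le> 1" by auto
qed

lemma unrevealed_Suc_le: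
  assumes "1 \<le> m"
  shows "unrevealed (Suc k) m \<le> unrevealed k m"
  using assms
proof (induction k arbitrary: m)
  case 0
  then show ?case using unrevealed_bounds[of m "Suc 0"] unrevealed_one[of "Suc 0"]
    by (cases "m = 1") (simp_all del: unrevealed.simps add: unrevealed.simps(1)[of m])
next
  case (Suc k)
  show ?case
  proof (cases "m = 1")
    case False
    then have m: "2 \<le> m" using Suc.prems by simp
    have "unrevealed (Suc k) i * unrevealed (Suc k) (m - i) \<le> unrevealed k i * unrevealed k (m - i)"
      if "1 \<le> i" "i < m" for i
      using that by (intro mult_mono Suc.IH unrevealed_bounds) auto
    then have "split_mean m (\<lambda>i. unrevealed (Suc k) i * unrevealed (Suc k) (m - i)) \<le>
        split_mean m (\<lambda>i. unrevealed k i * unrevealed k (m - i))"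
      by (intro split_mean_mono m)
    then show ?thesis using False by (simp del: unrevealed.simps add: unrevealed.simps(2)[of "Suc k"] unrevealed.simps(2)[of k])
  qed simp
qed

section \<open>Singletons do not appear early\<close>

text \<open>
  With \<open>y\<close> ranging over the probabilities of the \<open>2\<^sup>k\<close> words of length \<open>k\<close> over two letters of
  weights \<open>p\<close> and \<open>q\<close>, this is the sum of \<open>(1 - x y)\<^sup>m\<close>. For \<open>x = 1\<close> a summand is the probability
  that none of \<open>m\<close> independent random words starts with the given one.
\<close>
primrec leaf_sum :: "real \<Rightarrow> nat \<Rightarrow> nat \<Rightarrow> real" where
  "leaf_sum x 0 m = (1 - x) ^ m"
| "leaf_sum x (Suc k) m = leaf_sum (q * x) k m + leaf_sum (p * x) k m"

text \<open>Convexity of the power function: its graph lies below the chord over \<open>[y, 1]\<close>.\<close>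
lemma chord_power_le:
  fixes a b y :: real
  assumes "0 \<le> a" "0 \<le> b" "a + b = 1" "0 \<le> y" "y \<le> 1"
  shows "(a + b * y) ^ m \<le> a + b * y ^ m"
proof (induction m)
  case (Suc m)
  have "(a + b * y) ^ Suc m \<le> (a + b * y) * (a + b * y ^ m)"
    using Suc assms by (auto intro!: mult_left_mono)
  also have "\<dots> = a + b * y ^ Suc m - a * b * (1 - y) * (1 - y ^ m)"
  proof -
    have a: "a = 1 - b" using assms(3) by simp
    show ?thesis unfolding a by (simp add: algebra_simps)
  qed
  also have "\<dots> \<le> a + b * y ^ Suc m"
    using assms by (simp add: power_le_one)
  finally show ?case .
qed (use assms in simp)

text \<open>
  For unconditioned binomial \<open>i\<close> equality holds. Conditioning removes the outcomes \<open>i = 0\<close> and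
  \<open>i = m\<close>, where the two summands are \<open>1\<close> and \<open>(1 - x)\<^sup>m\<close> in some order (for \<open>k = 0\<close>). By
  convexity this removed value is at least the mean \<open>(1 - q x)\<^sup>m + (1 - p x)\<^sup>m\<close>, so the mean can
  only drop. The general case follows because \<open>leaf_sum\<close> is a sum of terms with \<open>k = 0\<close>.
\<close>
lemma split_mean_leaf_sum:
  assumes "2 \<le> m" "0 \<le> x" "x \<le> 1"
  shows "split_mean m (\<lambda>i. leaf_sum x k i + leaf_sum x k (m - i)) \<le> leaf_sum x (Suc k) m"
  using assms(2,3)
proof (induction k arbitrary: x)
  case 0
  define s where "s = 1 - p ^ m - q ^ m"
  have s: "0 < s" unfolding s_def using split_prob_pos(2)[OF assms(1)] .
  have qx: "q * (1 - x) + p = 1 - q * x" and px: "q + p * (1 - x) = 1 - p * x"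
    using p_plus_q by (simp_all add: algebra_simps)
  have 1: "(\<Sum>i\<le>m. real (m choose i) * q ^ i * p ^ (m - i) * (1 - x) ^ i) = (1 - q * x) ^ m"
    unfolding qx[symmetric] binomial_ring by (simp add: power_mult_distrib mult_ac)
  have 2: "(\<Sum>i\<le>m. real (m choose i) * q ^ i * p ^ (m - i) * (1 - x) ^ (m - i)) = (1 - p * x) ^ m"
    unfolding px[symmetric] binomial_ring by (simp add: power_mult_distrib mult_ac)
  have "s * split_mean m (\<lambda>i. (1 - x) ^ i + (1 - x) ^ (m - i)) =
      (1 - q * x) ^ m + (1 - p * x) ^ m - (1 - s) * (1 + (1 - x) ^ m)"
    unfolding s_def split_mean_binomial[OF assms(1)] distrib_left sum.distrib 1 2
    by (simp add: ring_distribs)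
  also have "\<dots> \<le> s * ((1 - q * x) ^ m + (1 - p * x) ^ m)"
  proof -
    have "(1 - q * x) ^ m + (1 - p * x) ^ m \<le> 1 + (1 - x) ^ m"
    proof -
      have "(1 - q * x) ^ m \<le> p + q * (1 - x) ^ m"
        unfolding qx[symmetric] add.commute[of "q * _" p]
        using p_pos q_pos p_plus_q 0 by (intro chord_power_le) auto
      moreover have "(1 - p * x) ^ m \<le> q + p * (1 - x) ^ m"
        unfolding px[symmetric]
        using p_pos q_pos p_plus_q 0 by (intro chord_power_le) auto
      moreover have "p * (1 - x) ^ m + q * (1 - x) ^ m = (1 - x) ^ m"
        by (simp flip: distrib_right add: p_plus_q)
      ultimately show ?thesis using p_plus_q by linarith
    qed
    moreover have "0 \<le> 1 - s" using p_pos q_pos by (simp add: s_def)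
    ultimately have "(1 - s) * ((1 - q * x) ^ m + (1 - p * x) ^ m) \<le> (1 - s) * (1 + (1 - x) ^ m)"
      by (rule mult_left_mono)
    then show ?thesis by (simp add: algebra_simps)
  qed
  finally show ?case using s by simp
next
  case (Suc k)
  have qx: "0 \<le> q * x" "q * x \<le> 1" and px: "0 \<le> p * x" "p * x \<le> 1"
    using Suc.prems p_lt_1 q_lt_1 p_pos q_pos by (simp_all add: mult_le_one)
  have "split_mean m (\<lambda>i. leaf_sum x (Suc k) i + leaf_sum x (Suc k) (m - i)) =
     split_mean m (\<lambda>i. leaf_sum (q * x) k i + leaf_sum (q * x) k (m - i)) +
     split_mean m (\<lambda>i. leaf_sum (p * x) k i + leaf_sum (p * x) k (m - i))"
    unfolding split_mean_add[symmetric] by (simp add: add_ac)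
  also have "\<dots> \<le> leaf_sum (q * x) (Suc k) m + leaf_sum (p * x) (Suc k) m"
    by (rule add_mono[OF Suc.IH[OF qx] Suc.IH[OF px]])
  finally show ?case by simp
qed

text \<open>
  The union bound over the two parts of a class, iterated. The choice \<open>x = 1/2\<close> with factor \<open>2\<close>
  makes the bound hold at \<open>k = 0\<close>, where a single object must get the value \<open>1\<close>: one needs
  \<open>2 (1 - x) \<ge> 1\<close>.
\<close>
lemma revealed_le_leaf_sum:
  assumes "1 \<le> m"
  shows "1 - unrevealed k m \<le> 2 * leaf_sum (1/2) k m"
  using assms
proof (induction k arbitrary: m)
  case (Suc k)
  show ?case
  proof (cases "m = 1")
    case True
    \<comment> \<open>there is at least one word, and each summand is at least \<open>1/2\<close>\<close>
    have "1/2 \<le> leaf_sum x k 1" if "0 \<le> x" "x \<le> 1/2" for x k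
      using that
    proof (induction k arbitrary: x)
      case (Suc k)
      have "q * x \<le> 1 * x" "p * x \<le> 1 * x"
        using Suc.prems p_lt_1 q_lt_1 p_pos q_pos by (intro mult_right_mono; simp)+
      then have "1/2 \<le> leaf_sum (q * x) k 1" "1/2 \<le> leaf_sum (p * x) k 1"
        using Suc.prems p_pos q_pos Suc.IH[of "q * x"] Suc.IH[of "p * x"] by simp_all
      then show ?case by simp
    qed simp
    from this[of "1/2" "Suc k"] show ?thesis using True by simp
  next
    case False
    then have m: "2 \<le> m" using Suc.prems by simp
    have "1 - unrevealed (Suc k) m =
        split_mean m (\<lambda>i. 1 - unrevealed k i * unrevealed k (m - i))"
      using False by (simp add: split_mean_diff split_mean_const[OF m])
    also have "\<dots> \<le> split_mean m (\<lambda>i. 2 * (leaf_sum (1/2) k i + leaf_sum (1/2) k (m - i)))"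
    proof (rule split_mean_mono[OF m])
      fix i assume i: "1 \<le> i" "i < m"
      have "0 \<le> (1 - unrevealed k i) * (1 - unrevealed k (m - i))"
        using i unrevealed_bounds by simp
      then have "1 - unrevealed k i * unrevealed k (m - i) \<le>
          (1 - unrevealed k i) + (1 - unrevealed k (m - i))"
        by (simp add: algebra_simps)
      also have "\<dots> \<le> 2 * leaf_sum (1/2) k i + 2 * leaf_sum (1/2) k (m - i)"
        using i by (intro add_mono Suc.IH) auto
      finally show "1 - unrevealed k i * unrevealed k (m - i) \<le>
          2 * (leaf_sum (1/2) k i + leaf_sum (1/2) k (m - i))" by simp
    qed
    also have "\<dots> \<le> 2 * leaf_sum (1/2) (Suc k) m"
      unfolding split_mean_cmult by (intro mult_left_mono split_mean_leaf_sum m) auto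
    finally show ?thesis .
  qed
qed (cases "m = 1"; simp)

text \<open>
  A word with \<open>j\<close> letters of weight \<open>p\<close> has probability \<open>q\<^sup>k (p/q)\<^sup>j \<ge> q\<^sup>k (1 + j (p/q - 1))\<close> by
  Bernoulli's inequality, so summing over words gives a binomial expansion. The induction does
  both at once. The bound decreases in \<open>y\<close>, hence any lower bound \<open>y\<close> of \<open>m x q\<^sup>k\<close> may be used.
\<close>
lemma leaf_sum_le_exp:
  assumes "0 \<le> x" "x \<le> 1" "q \<le> p" "y \<le> real m * x * q ^ k"
  shows "leaf_sum x k m \<le> exp (- y) * (1 + exp (- (p / q - 1) * y)) ^ k"
proof -
  define c where "c = p / q - 1"
  have c: "0 \<le> c" using assms(3) q_pos by (simp add: c_def)
  have "leaf_sum x k m \<le> exp (- (real m * x * q ^ k)) *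
      (1 + exp (- c * (real m * x * q ^ k))) ^ k"
    using assms(1,2)
  proof (induction k arbitrary: x)
    case 0
    have "(1 - x) ^ m \<le> exp (- x) ^ m"
      using 0 exp_ge_add_one_self[of "- x"] by (intro power_mono) auto
    then show ?case by (simp add: exp_of_nat_mult[symmetric] mult_ac)
  next
    case (Suc k)
    define y where "y = real m * x * q ^ Suc k"
    define E where "E = exp (- c * y)"
    have y: "0 \<le> y" using Suc.prems q_pos by (simp add: y_def)
    have qx: "0 \<le> q * x" "q * x \<le> 1" and px: "0 \<le> p * x" "p * x \<le> 1"
      using Suc.prems p_lt_1 q_lt_1 p_pos q_pos by (simp_all add: mult_le_one)
    have yq: "real m * (q * x) * q ^ k = y" by (simp add: y_def)
    have yp: "real m * (p * x) * q ^ k = (p / q) * y" using q_pos by (simp add: y_def)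
    have yy: "y \<le> (p / q) * y"
      using assms(3) q_pos y mult_right_mono[of 1 "p / q" y] by simp
    have "leaf_sum (q * x) k m \<le> exp (- y) * (1 + E) ^ k"
      using Suc.IH[OF qx] unfolding yq E_def .
    moreover have "leaf_sum (p * x) k m \<le> exp (- y) * E * (1 + E) ^ k"
    proof -
      have "leaf_sum (p * x) k m \<le> exp (- ((p / q) * y)) * (1 + exp (- c * ((p / q) * y))) ^ k"
        using Suc.IH[OF px] unfolding yp .
      also have "exp (- ((p / q) * y)) = exp (- y) * E"
        by (simp add: E_def c_def algebra_simps flip: exp_add)
      also have "exp (- y) * E * (1 + exp (- c * ((p / q) * y))) ^ k \<le> exp (- y) * E * (1 + E) ^ k"
        unfolding E_def using mult_left_mono[OF yy c]
        by (intro mult_left_mono power_mono add_mono) (auto intro: add_nonneg_nonneg)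
      finally show ?thesis .
    qed
    ultimately show ?case
      unfolding y_def[symmetric] E_def[symmetric] by (simp add: algebra_simps)
  qed
  also have "\<dots> \<le> exp (- y) * (1 + exp (- c * y)) ^ k"
    using assms(4) mult_left_mono[OF assms(4) c]
    by (intro mult_mono power_mono add_mono) (auto intro: add_nonneg_nonneg)
  finally show ?thesis unfolding c_def .
qed

section \<open>A singleton appears soon\<close>

text \<open>
  The derivative in \<open>z\<close> of the binomial theorem for \<open>(q z + p)\<^sup>m\<close>.
\<close>
lemma sum_binomial_deriv:
  "(\<Sum>i\<le>m. real (m choose i) * q ^ i * p ^ (m - i) * (real i * z ^ (i - 1))) =
     real m * q * (q * z + p) ^ (m - 1)"
proof (cases m)
  case (Suc n)
  have summand: "real (Suc n choose Suc i) * q ^ Suc i * p ^ (Suc n - Suc i) * (real (Suc i) * z ^ (Suc i - 1)) =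
      real (Suc n) * q * (real (n choose i) * (q * z) ^ i * p ^ (n - i))" for i
  proof -
    have "real (Suc n choose Suc i) * real (Suc i) = real (Suc n) * real (n choose i)"
      by (metis Suc_times_binomial_eq of_nat_mult)
    then show ?thesis by (simp add: power_mult_distrib del: of_nat_Suc binomial_Suc_Suc)
  qed
  then show ?thesis
    unfolding Suc sum.atMost_Suc_shift summand binomial_ring by (simp add: sum_distrib_left)
qed simp

text \<open>
  The left-hand side is the probability that exactly one of \<open>m\<close> objects survives \<open>k\<close> rounds of
  independent thinning with survival probability \<open>q\<close>. The part of the class left out by all
  queries evolves like this thinning, except that a round in which all objects or none survive is
  redrawn. A redrawn round is worth at least \<open>q\<close> times what surviving unchanged, with one round
  fewer to go, is worth, and it occurs with probability \<open>p\<^sup>m + q\<^sup>m\<close> instead of \<open>q\<^sup>m\<close>. As \<open>q \<le> p\<close>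
  gives \<open>q\<^sup>m \<le> (p\<^sup>m + q\<^sup>m) q\<close>, redrawing does not lower the chance of a singleton.
\<close>
lemma revealed_ge_binomial:
  assumes "q \<le> p" "1 \<le> m"
  shows "real m * q ^ k * (1 - q ^ k) ^ (m - 1) \<le> 1 - unrevealed k m"
  using assms(2)
proof (induction k arbitrary: m)
  case 0
  then show ?case by (cases "m = 1") (auto simp: power_0_left)
next
  case (Suc k)
  define f where "f j m = real m * q ^ j * (1 - q ^ j) ^ (m - 1)" for j m
  show ?case
  proof (cases "m = 1")
    case False
    then have m: "2 \<le> m" using Suc.prems by simp
    define s where "s = 1 - p ^ m - q ^ m"
    have s: "0 < s" unfolding s_def using split_prob_pos(2)[OF m] .
    have qk: "0 \<le> 1 - q ^ k" "1 - q ^ k \<le> 1 - q ^ Suc k"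
      using q_pos q_lt_1 by (simp_all add: power_le_one power_decreasing[of k "Suc k"] mult_left_le_one_le)
    have fpos: "0 \<le> f k m" using qk q_pos by (simp add: f_def)
    have fk: "q * f k m \<le> f (Suc k) m"
    proof -
      have "q * f k m = real m * q ^ Suc k * (1 - q ^ k) ^ (m - 1)" by (simp add: f_def)
      also have "\<dots> \<le> f (Suc k) m"
        unfolding f_def using qk q_pos by (intro mult_left_mono power_mono) auto
      finally show ?thesis .
    qed
    have qm: "q ^ m \<le> (p ^ m + q ^ m) * q"
    proof -
      obtain n where n: "m = Suc n" using m by (cases m) auto
      have "q ^ n * p \<le> p ^ n * p"
        using assms(1) q_pos p_pos by (intro mult_right_mono power_mono) auto
      moreover have "q ^ m = q ^ m * q + q ^ m * p"
        by (simp flip: distrib_left add: p_plus_q add.commute)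
      moreover have "q ^ m * p \<le> p ^ m * q"
      proof -
        have "q ^ n * p * q \<le> p ^ n * p * q" by (rule mult_right_mono[OF calculation(1)]) (use q_pos in simp)
        then show ?thesis by (simp add: n mult_ac)
      qed
      ultimately show ?thesis by (simp add: algebra_simps)
    qed
    have full: "(\<Sum>i\<le>m. real (m choose i) * q ^ i * p ^ (m - i) * f k i) = f (Suc k) m"
    proof -
      have "(\<Sum>i\<le>m. real (m choose i) * q ^ i * p ^ (m - i) * f k i) =
        q ^ k * (\<Sum>i\<le>m. real (m choose i) * q ^ i * p ^ (m - i) * (real i * (1 - q ^ k) ^ (i - 1)))"
        by (simp add: f_def sum_distrib_left mult_ac)
      also have "q * (1 - q ^ k) + p = 1 - q ^ Suc k"
        using p_plus_q by (simp add: algebra_simps)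
      ultimately show ?thesis
        unfolding sum_binomial_deriv by (simp only:) (simp add: f_def)
    qed
    have "q ^ m * f k m \<le> (p ^ m + q ^ m) * q * f k m"
      using qm fpos by (rule mult_right_mono)
    also have "\<dots> \<le> (p ^ m + q ^ m) * f (Suc k) m"
      unfolding mult.assoc using fk p_pos q_pos by (intro mult_left_mono) auto
    finally have "s * f (Suc k) m \<le> s * split_mean m (f k)"
      unfolding s_def split_mean_binomial[OF m] full by (simp add: f_def algebra_simps)
    then have "f (Suc k) m \<le> split_mean m (f k)" using s by simp
    also have "\<dots> \<le> split_mean m (\<lambda>i. 1 - unrevealed k i * unrevealed k (m - i))"
    proof (rule split_mean_mono[OF m])
      fix i assume i: "1 \<le> i" "i < m"
      have "f k i \<le> 1 - unrevealed k i" unfolding f_def using Suc.IH i by simp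
      also have "unrevealed k i * unrevealed k (m - i) \<le> unrevealed k i"
        using i unrevealed_bounds by (intro mult_left_le) auto
      then have "1 - unrevealed k i \<le> 1 - unrevealed k i * unrevealed k (m - i)" by simp
      finally show "f k i \<le> 1 - unrevealed k i * unrevealed k (m - i)" .
    qed
    also have "\<dots> = 1 - unrevealed (Suc k) m"
      using False by (simp add: split_mean_diff split_mean_const[OF m])
    finally show ?thesis by (simp add: f_def)
  next
    case True
    then show ?thesis using q_pos q_lt_1 by (simp add: mult_le_one power_le_one del: unrevealed.simps)
  qed
qed

lemma one_minus_ge_exp:
  fixes y :: real
  assumes "0 \<le> y" "y \<le> 1/2"
  shows "exp (- 2 * y) \<le> 1 - y"
proof -
  have "y\<^sup>2 \<le> y / 2" using assms by (simp add: power2_eq_square mult_left_mono[of y "1/2" y, simplified])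
  then have "- 2 * y \<le> ln (1 - y)"
    using ln_one_minus_pos_lower_bound[OF assms] by simp
  then show ?thesis using assms by (simp add: ln_ge_iff)
qed

text \<open>
  Once \<open>m q\<^sup>k\<close> lies in \<open>[q, L]\<close>, the thinning probability is at least \<open>q e\<^bsup>-2L\<^esup>\<close>. If \<open>m q\<^sup>k\<close> is
  smaller than \<open>q\<close>, that range was passed at an earlier round, and the chance of a singleton only
  grows with the number of rounds.
\<close>
lemma unrevealed_le:
  assumes "q \<le> p" "1 \<le> k" "1 \<le> m" "1 \<le> L" "real m * q ^ k \<le> L"
  shows "unrevealed k m \<le> 1 - q * exp (- 2 * L)"
  using assms(2,5)
proof (induction k)
  case (Suc k)
  show ?case
  proof (cases "q \<le> real m * q ^ Suc k")
    case True
    have "q ^ Suc k \<le> 1/2"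
    proof -
      have "q ^ Suc k \<le> q ^ 1" using q_pos q_lt_1 by (intro power_decreasing) auto
      then show ?thesis using assms(1) p_plus_q by simp
    qed
    then have e: "exp (- 2 * q ^ Suc k) \<le> 1 - q ^ Suc k"
      using q_pos by (intro one_minus_ge_exp) auto
    have "q * exp (- 2 * L) \<le> q * exp (- 2 * (real m * q ^ Suc k))"
      using Suc.prems q_pos by simp
    also have "exp (- 2 * (real m * q ^ Suc k)) = exp (- 2 * q ^ Suc k) ^ m"
      by (simp add: exp_of_nat_mult[symmetric] mult_ac)
    also have "\<dots> \<le> exp (- 2 * q ^ Suc k) ^ (m - 1)"
      using q_pos by (intro power_decreasing) auto
    also have "\<dots> \<le> (1 - q ^ Suc k) ^ (m - 1)"
      using e by (intro power_mono) auto
    also have "q * (1 - q ^ Suc k) ^ (m - 1) \<le> real m * q ^ Suc k * (1 - q ^ Suc k) ^ (m - 1)"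
      using True e order_trans[OF exp_ge_zero e] by (intro mult_right_mono zero_le_power) auto
    also have "\<dots> \<le> 1 - unrevealed (Suc k) m"
      by (rule revealed_ge_binomial[OF assms(1,3)])
    finally show ?thesis using q_pos by (simp add: mult_left_mono del: unrevealed.simps)
  next
    case False
    then have lt: "real m * q ^ k < 1" using q_pos by simp
    have "k \<noteq> 0" using lt assms(3) by (intro notI) simp
    then have "unrevealed k m \<le> 1 - q * exp (- 2 * L)"
      using lt assms(4) by (intro Suc.IH) auto
    then show ?thesis using unrevealed_Suc_le[OF assms(3), of k] by linarith
  qed
qed simp

text \<open>
  Conditioning raises the mean of the part left out by at most a constant, since \<open>m p\<^sup>m\<close> is
  bounded.
\<close>
lemma split_mean_id_le:
  assumes "2 \<le> m"
  shows "split_mean m real \<le> q * real m + 1 / (2 * q)"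
proof -
  define s where "s = 1 - p ^ m - q ^ m"
  have s: "0 < s" "2 * p * q \<le> s" unfolding s_def using split_prob_pos[OF assms] by auto
  have "s * split_mean m real = real m * q - q ^ m * real m"
    using sum_binomial_deriv[of m 1] unfolding s_def split_mean_binomial[OF assms]
    by (simp add: p_plus_q add.commute)
  also have "\<dots> \<le> s * (q * real m) + p"
  proof -
    have "real m * p ^ m \<le> (\<Sum>j<m. p ^ Suc j)"
    proof -
      have "(\<Sum>j<m. p ^ m) \<le> (\<Sum>j<m. p ^ Suc j)"
        using p_pos p_lt_1 by (intro sum_mono power_decreasing) auto
      then show ?thesis by simp
    qed
    also have "\<dots> = p * (\<Sum>j<m. p ^ j)" by (simp add: sum_distrib_left)
    also have "(\<Sum>j<m. p ^ j) = (1 - p ^ m) / (1 - p)"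
      using p_lt_1 by (simp add: sum_gp_strict)
    also have "\<dots> \<le> 1 / q"
      using p_plus_q p_pos q_pos by (simp add: divide_right_mono flip: p_plus_q)
    finally have "q * (real m * p ^ m) \<le> p"
      using p_pos q_pos by (simp add: field_simps)
    moreover have "q ^ m * real m * q \<le> q ^ m * real m"
      using q_pos q_lt_1 by (intro mult_left_le) auto
    ultimately show ?thesis by (simp add: s_def algebra_simps)
  qed
  also have "\<dots> \<le> s * (q * real m + 1 / (2 * q))"
  proof -
    have "p \<le> s * (1 / (2 * q))" using s(2) q_pos by (simp add: field_simps)
    then show ?thesis by (simp add: algebra_simps)
  qed
  finally show ?thesis using s(1) by simp
qed

text \<open>
  Follow the part left out of each query. As long as the current class is not too large for
  \<open>unrevealed_le\<close>, the sibling of its part left out multiplies the probability of no singleton by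
  at most \<open>1 - q e\<^bsup>-2L\<^esup>\<close>. The second summand pays for the rounds in which the class is too large
  for that: it exceeds \<open>1\<close> there, and in the mean it does not increase, up to the bounded
  correction of \<open>split_mean_id_le\<close>, whose accumulated effect is the constant \<open>1 / (2 p q)\<close>. It is
  Markov's inequality built into the induction.
\<close>
lemma unrevealed_le_spine:
  assumes "q \<le> p" "1 \<le> m" "1 \<le> L"
  shows "unrevealed (Suc k) m \<le>
    (1 - q * exp (- 2 * L)) ^ k + (real m * q ^ k + 1 / (2 * p * q)) / L"
proof -
  define d where "d = 1 - q * exp (- 2 * L)"
  define D where "D = 1 / (2 * p * q)"
  have "q * exp (- 2 * L) \<le> 1 * 1"
    using q_pos q_lt_1 assms by (intro mult_mono) auto
  then have d: "0 \<le> d" "d \<le> 1" using q_pos by (auto simp: d_def)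
  have D: "0 < D" using p_pos q_pos by (simp add: D_def)
  have "unrevealed (Suc k) m \<le> d ^ k + (real m * q ^ k + D * (1 - q ^ k)) / L"
    using assms(2)
  proof (induction k arbitrary: m)
    case 0
    then show ?case using unrevealed_bounds(2)[of m "Suc 0"] assms(3)
      by (simp del: unrevealed.simps add: add_increasing2)
  next
    case (Suc k)
    have qk: "0 \<le> 1 - q ^ k" "0 \<le> 1 - q ^ Suc k" 
      using q_pos q_lt_1 by (simp_all add: power_le_one mult_le_one)
    have pos: "0 \<le> D * (1 - q ^ Suc k)" "0 \<le> real m * q ^ Suc k"
      using qk D q_pos by auto
    consider "m = 1" | "2 \<le> m" "real m * q ^ Suc k \<le> L" | "L \<le> real m * q ^ Suc k"
      using Suc.prems by linarith
    then show ?case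
    proof cases
      case 1
      then show ?thesis using pos assms(3) d 
        by (auto simp del: unrevealed.simps intro!: add_nonneg_nonneg divide_nonneg_pos)
    next
      case 2
      have "unrevealed (Suc (Suc k)) m =
          split_mean m (\<lambda>i. unrevealed (Suc k) i * unrevealed (Suc k) (m - i))"
        using 2(1) by (simp only: unrevealed.simps(2)[of "Suc k"]) auto
      also have "\<dots> \<le> split_mean m (\<lambda>i. d ^ Suc k + (q ^ k / L * real i + D * (1 - q ^ k) / L))"
      proof (rule split_mean_mono[OF 2(1)])
        fix i assume i: "1 \<le> i" "i < m"
        have "real (m - i) * q ^ Suc k \<le> real m * q ^ Suc k"
          using q_pos by (intro mult_right_mono) auto
        then have "unrevealed (Suc k) (m - i) \<le> d"
          unfolding d_def using i 2 assms by (intro unrevealed_le) auto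
        then have "unrevealed (Suc k) i * unrevealed (Suc k) (m - i) \<le> unrevealed (Suc k) i * d"
          using i unrevealed_bounds by (intro mult_left_mono) (auto simp del: unrevealed.simps)
        also have "\<dots> \<le> (d ^ k + (real i * q ^ k + D * (1 - q ^ k)) / L) * d"
          using Suc.IH i d by (intro mult_right_mono) auto
        also have "\<dots> \<le> d ^ Suc k + (real i * q ^ k + D * (1 - q ^ k)) / L"
        proof -
          have "0 \<le> (real i * q ^ k + D * (1 - q ^ k)) / L"
            using qk D assms(3) q_pos by auto
          from mult_left_le[OF d(2) this] show ?thesis
            unfolding distrib_right by (simp add: mult.commute)
        qed
        finally show "unrevealed (Suc k) i * unrevealed (Suc k) (m - i) \<le>
            d ^ Suc k + (q ^ k / L * real i + D * (1 - q ^ k) / L)"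
          by (simp add: add_divide_distrib mult_ac)
      qed
      also have "\<dots> = d ^ Suc k + (q ^ k * split_mean m real + D * (1 - q ^ k)) / L"
        unfolding split_mean_add split_mean_cmult split_mean_const[OF 2(1)]
        by (simp add: add_divide_distrib)
      also have "\<dots> \<le> d ^ Suc k + (q ^ k * (q * real m + 1 / (2 * q)) + D * (1 - q ^ k)) / L"
        using split_mean_id_le[OF 2(1)] q_pos assms(3)
        by (intro add_left_mono divide_right_mono add_right_mono mult_left_mono) auto
      also have "q ^ k * (q * real m + 1 / (2 * q)) + D * (1 - q ^ k) =
          real m * q ^ Suc k + D * (1 - q ^ Suc k)"
      proof -
        have D_eq: "1 / (2 * q) = D * (1 - q)"
          using p_pos q_pos by (simp add: D_def field_simps flip: p_plus_q)
        show ?thesis unfolding D_eq by (simp add: algebra_simps)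
      qed
      finally show ?thesis .
    next
      case 3
      then have "1 \<le> (real m * q ^ Suc k + D * (1 - q ^ Suc k)) / L"
        using pos assms(3) by (simp add: field_simps del: power_Suc)
      moreover have "0 \<le> d ^ Suc k" using d by simp
      ultimately show ?thesis
        using unrevealed_bounds(2)[OF Suc.prems, of "Suc (Suc k)"] by linarith
    qed
  qed
  also have "\<dots> \<le> d ^ k + (real m * q ^ k + D) / L"
    using D assms(3) q_pos
    by (intro add_left_mono divide_right_mono) (auto simp: mult_left_le)
  finally show ?thesis by (simp add: d_def D_def)
qed

text \<open>
  The exponent is a lower bound on the number of classes of size at most \<open>s\<close> among \<open>2\<^sup>h\<close> classes
  of total size \<open>m\<close>, which exist after \<open>h\<close> rounds without a singleton, since fewer than \<open>m / s\<close> of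
  them are larger. It is additive under splitting, so no averaging over the sizes of the parts is
  needed.
\<close>
lemma unrevealed_le_powr:
  assumes "0 < d" "d \<le> 1" "0 < s" "1 \<le> m"
    and small: "\<And>i. 1 \<le> i \<Longrightarrow> real i \<le> s \<Longrightarrow> unrevealed j i \<le> d"
  shows "unrevealed (h + j) m \<le> d powr (2 ^ h - real m / s)"
  using assms(4)
proof (induction h arbitrary: m)
  case 0
  show ?case
  proof (cases "real m \<le> s")
    case True
    have "unrevealed j m \<le> d powr 1" using small[OF 0 True] assms by simp
    also have "\<dots> \<le> d powr (1 - real m / s)"
      using assms(1-3) by (intro powr_mono') auto
    finally show ?thesis by simp
  next
    case False
    have "unrevealed j m \<le> d powr 0" using unrevealed_bounds(2)[OF 0] assms(1) by simp
    also have "\<dots> \<le> d powr (1 - real m / s)"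
      using assms(1-3) False by (intro powr_mono') (auto simp: field_simps)
    finally show ?thesis by simp
  qed
next
  case (Suc h)
  show ?case
  proof (cases "m = 1")
    case False
    then have m: "2 \<le> m" using Suc.prems by simp
    have "unrevealed (Suc h + j) m =
        split_mean m (\<lambda>i. unrevealed (h + j) i * unrevealed (h + j) (m - i))"
      using False by simp
    also have "\<dots> \<le> split_mean m (\<lambda>_. d powr (2 ^ Suc h - real m / s))"
    proof (rule split_mean_mono[OF m])
      fix i assume i: "1 \<le> i" "i < m"
      have "unrevealed (h + j) i * unrevealed (h + j) (m - i) \<le>
          d powr (2 ^ h - real i / s) * d powr (2 ^ h - real (m - i) / s)"
        using i unrevealed_bounds by (intro mult_mono Suc.IH) auto
      also have "\<dots> = d powr (2 ^ Suc h - real m / s)"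
        using i by (simp add: of_nat_diff diff_divide_distrib flip: powr_add)
      finally show "unrevealed (h + j) i * unrevealed (h + j) (m - i) \<le> \<dots>" .
    qed
    finally show ?thesis by (simp add: split_mean_const[OF m])
  qed simp
qed

end

section \<open>Independent splitting of the classes of a partition\<close>

lemma pmf_random_subset_pmf:
  assumes "finite A" "0 < p" "p < 1" "R \<subseteq> A"
  shows "pmf (random_subset_pmf p A) R = (\<Prod>a\<in>A. if a \<in> R then p else 1 - p)"
proof -
  let ?M = "Pi_pmf A False (\<lambda>_. bernoulli_pmf p)"
  have supp: "set_pmf ?M = PiE_dflt A False (\<lambda>_. UNIV)"
    using assms by (simp add: set_Pi_pmf comp_def)
  have "inj_on (\<lambda>f. {a \<in> A. f a}) (set_pmf ?M)"
    unfolding supp by (rule inj_onI) (auto simp: PiE_dflt_def fun_eq_iff)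
  moreover have "(\<lambda>a. a \<in> R) \<in> set_pmf ?M"
    unfolding supp using assms(4) by (auto simp: PiE_dflt_def)
  ultimately have "pmf (map_pmf (\<lambda>f. {a \<in> A. f a}) ?M) {a \<in> A. a \<in> R} = pmf ?M (\<lambda>a. a \<in> R)"
    by (rule pmf_map_inj)
  moreover have "{a \<in> A. a \<in> R} = R" using assms(4) by auto
  moreover have "pmf ?M (\<lambda>a. a \<in> R) = (\<Prod>a\<in>A. if a \<in> R then p else 1 - p)"
    using assms by (subst pmf_Pi') (auto intro!: prod.cong)
  ultimately show ?thesis unfolding random_subset_pmf_def by simp
qed

text \<open>
  A subset of \<open>X\<close> is the same as an independent choice of a subset of each class.
\<close>
lemma sum_Pow_partition:
  fixes f :: "'a set \<Rightarrow> 'a set \<Rightarrow> real"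
  assumes "finite X" "partition_on X P"
  shows "(\<Sum>T\<in>Pow X. \<Prod>S\<in>P. f S (S \<inter> T)) = (\<Prod>S\<in>P. \<Sum>T\<in>Pow S. f S T)"
proof -
  have P: "\<Union>P = X" "disjoint P" using assms(2) by (auto simp: partition_on_def)
  have fin: "finite P" using finite_elements[OF assms] .
  have finS: "finite S" if "S \<in> P" for S using finite_subset[OF Union_upper[OF that]] P(1) assms(1) by simp
  have sub: "g S \<subseteq> S" if "g \<in> PiE P Pow" "S \<in> P" for g S
  proof -
    have "g S \<in> Pow S" using that by (rule PiE_mem)
    then show ?thesis by blast
  qed
  have pick: "S \<inter> \<Union>(g ` P) = g S" if "g \<in> PiE P Pow" "S \<in> P" for g S
  proof -
    have "g S' \<inter> S = {}" if "S' \<in> P" "S' \<noteq> S" for S'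
      using disjointD[OF P(2) \<open>S' \<in> P\<close> \<open>S \<in> P\<close> that(2)] sub[OF \<open>g \<in> PiE P Pow\<close> that(1)]
      by blast
    moreover have "g S \<subseteq> S" by (rule sub[OF that])
    ultimately show ?thesis using that(2) by blast
  qed
  have "(\<Prod>S\<in>P. \<Sum>T\<in>Pow S. f S T) = (\<Sum>g\<in>PiE P Pow. \<Prod>S\<in>P. f S (g S))"
    using fin finS by (intro prod_sum_PiE) auto
  also have "\<dots> = (\<Sum>T\<in>Pow X. \<Prod>S\<in>P. f S (S \<inter> T))"
  proof (rule sum.reindex_bij_witness[where i = "\<lambda>T. restrict (\<lambda>S. S \<inter> T) P" and j = "\<lambda>g. \<Union>(g ` P)"])
    fix g assume g: "g \<in> PiE P Pow"
    show "restrict (\<lambda>S. S \<inter> \<Union> (g ` P)) P = g"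
    proof
      fix S show "restrict (\<lambda>S. S \<inter> \<Union> (g ` P)) P S = g S"
        using pick[OF g] PiE_arb[OF g] by (cases "S \<in> P") simp_all
    qed
    show "\<Union> (g ` P) \<in> Pow X" unfolding P(1)[symmetric] using sub[OF g] by blast
    show "(\<Prod>S\<in>P. f S (S \<inter> \<Union> (g ` P))) = (\<Prod>S\<in>P. f S (g S))"
      using pick[OF g] by simp
  next
    fix T assume "T \<in> Pow X"
    then show "\<Union> (restrict (\<lambda>S. S \<inter> T) P ` P) = T" using P(1) by auto
  qed auto
  finally show ?thesis ..
qed

lemma sum_Pow_weight:
  fixes a b :: real
  assumes "finite S"
  shows "(\<Sum>T\<in>Pow S. (\<Prod>x\<in>S. if x \<in> T then a else b) * f (card T)) =
    (\<Sum>i\<le>card S. real (card S choose i) * a ^ i * b ^ (card S - i) * f i)"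
proof -
  have "(\<Prod>x\<in>S. if x \<in> T then a else b) = a ^ card T * b ^ (card S - card T)" if "T \<subseteq> S" for T
  proof -
    have "S \<inter> T = T" "S \<inter> {x. x \<notin> T} = S - T" using that by auto
    then show ?thesis
      using assms that finite_subset[OF that assms] by (simp add: prod.If_cases card_Diff_subset Compl_eq)
  qed
  then have "(\<Sum>T\<in>Pow S. (\<Prod>x\<in>S. if x \<in> T then a else b) * f (card T)) =
      (\<Sum>T\<in>Pow S. a ^ card T * b ^ (card S - card T) * f (card T))"
    by (intro sum.cong) auto
  also have "\<dots> = (\<Sum>i\<in>{..card S}. \<Sum>T | T \<in> Pow S \<and> card T = i.
      a ^ card T * b ^ (card S - card T) * f (card T))"
    using assms by (intro sum.group[symmetric]) (auto intro: card_mono)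
  also have "\<dots> = (\<Sum>i\<le>card S. real (card S choose i) * a ^ i * b ^ (card S - i) * f i)"
    using n_subsets[OF assms] by (intro sum.cong) (simp_all add: mult_ac)
  finally show ?thesis .
qed

text \<open>
  Here \<open>T\<close> is the part of the class \<open>S\<close> that a query leaves out. The terms set to \<open>0\<close> are the
  inconclusive queries, and \<open>1 - p\<^sup>m - q\<^sup>m\<close> is the probability of a conclusive one.
\<close>
lemma (in split_bias) sum_proper_subsets:
  assumes "finite S" "2 \<le> card S"
  shows "(\<Sum>T\<in>Pow S. if T = {} \<or> T = S then 0
             else (\<Prod>x\<in>S. if x \<in> T then q else p) * f (card T)) =
    (1 - p ^ card S - q ^ card S) * split_mean (card S) f"
proof -
  define g where "g i = (if i = 0 \<or> i = card S then 0 else f i)" for i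
  have "(if T = {} \<or> T = S then 0 else (\<Prod>x\<in>S. if x \<in> T then q else p) * f (card T)) =
      (\<Prod>x\<in>S. if x \<in> T then q else p) * g (card T)" if "T \<in> Pow S" for T
    using that assms(1) by (auto simp: g_def card_eq_0_iff finite_subset dest: card_subset_eq)
  then have "(\<Sum>T\<in>Pow S. if T = {} \<or> T = S then 0
        else (\<Prod>x\<in>S. if x \<in> T then q else p) * f (card T)) =
      (\<Sum>T\<in>Pow S. (\<Prod>x\<in>S. if x \<in> T then q else p) * g (card T))"
    by (intro sum.cong) auto
  also have "\<dots> = (1 - p ^ card S - q ^ card S) * split_mean (card S) g"
    unfolding sum_Pow_weight[OF assms(1)] split_mean_binomial[OF assms(2)] by (simp add: g_def)
  also have "split_mean (card S) g = split_mean (card S) f"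
    unfolding split_mean_def g_def by (intro arg_cong2[where f = "(/)"] sum.cong) auto
  finally show ?thesis .
qed

text \<open>
  From here on a query is recorded by what it leaves out of each class, so that everything takes
  place in \<open>X\<close> rather than among the labels.
\<close>
lemma conclusive_iff:
  assumes "\<And>S. S \<in> P \<Longrightarrow> 2 \<le> card S"
  shows "conclusive \<phi> P R \<longleftrightarrow> (\<forall>S\<in>P. S - \<phi> -` R \<noteq> {} \<and> S - \<phi> -` R \<noteq> S)"
proof -
  have "\<phi> ` S \<inter> R \<noteq> {} \<longleftrightarrow> S - \<phi> -` R \<noteq> S" "\<phi> ` S - R \<noteq> {} \<longleftrightarrow> S - \<phi> -` R \<noteq> {}" for S
    by auto
  then show ?thesis using assms unfolding conclusive_def by auto
qed

lemma partition_on_split_classes: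
  assumes "partition_on X P" "conclusive \<phi> P R"
  shows "partition_on X (split_classes \<phi> P R)"
proof -
  define C where "C S = (if card S \<ge> 2 then {S \<inter> \<phi> -` R, S - \<phi> -` R} else {S})" for S
  have C: "split_classes \<phi> P R = (\<Union>S\<in>P. C S)" by (simp add: split_classes_def C_def)
  have P: "\<Union>P = X" "disjoint P" "{} \<notin> P" using assms(1) by (auto simp: partition_on_def)
  show ?thesis
  proof (rule partition_onI)
    show "{} \<notin> split_classes \<phi> P R"
      using assms(2) P(3) unfolding C by (auto simp: C_def conclusive_def split: if_splits)
  next
    have "\<Union>(C S) = S" for S by (auto simp: C_def)
    then show "\<Union>(split_classes \<phi> P R) = X" unfolding C using P(1) by blast
  next
    fix a b assume "a \<in> split_classes \<phi> P R" "b \<in> split_classes \<phi> P R" and ne: "a \<noteq> b"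
    then obtain S T where ST: "S \<in> P" "T \<in> P" "a \<in> C S" "b \<in> C T" unfolding C by blast
    show "disjnt a b"
    proof (cases "S = T")
      case True
      then show ?thesis using ST(3,4) ne by (auto simp: C_def disjnt_def split: if_splits)
    next
      case False
      then have "S \<inter> T = {}" using disjointD[OF P(2)] ST by blast
      moreover have "a \<subseteq> S" "b \<subseteq> T" using ST(3,4) by (auto simp: C_def split: if_splits)
      ultimately show ?thesis by (auto simp: disjnt_def)
    qed
  qed
qed

lemma prod_split_classes:
  fixes h :: "'a set \<Rightarrow> real"
  assumes "finite X" "partition_on X P" "\<And>S. S \<in> P \<Longrightarrow> 2 \<le> card S" "conclusive \<phi> P R"
  shows "(\<Prod>S\<in>split_classes \<phi> P R. h S) = (\<Prod>S\<in>P. h (S - \<phi> -` R) * h (S - (S - \<phi> -` R)))"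
proof -
  have P: "\<Union>P = X" "disjoint P" using assms(2) by (auto simp: partition_on_def)
  have conc: "conclusive \<phi> P R \<longleftrightarrow> (\<forall>S\<in>P. S - \<phi> -` R \<noteq> {} \<and> S - \<phi> -` R \<noteq> S)" for R
    by (rule conclusive_iff) (rule assms(3))
  define C where "C S = {S \<inter> \<phi> -` R, S - \<phi> -` R}" for S
  have "split_classes \<phi> P R = (\<Union>S\<in>P. C S)"
    unfolding split_classes_def C_def using assms(3) by (intro SUP_cong) auto
  then have "(\<Prod>S\<in>split_classes \<phi> P R. h S) = (\<Prod>S\<in>\<Union>(C ` P). h S)" by simp
  also have "\<dots> = (\<Prod>S\<in>P. \<Prod>T\<in>C S. h T)"
  proof (rule prod.UNION_disjoint)
    show "finite P" using finite_elements[OF assms(1,2)] .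
    show "\<forall>S\<in>P. finite (C S)" by (simp add: C_def)
    show "\<forall>S\<in>P. \<forall>T\<in>P. S \<noteq> T \<longrightarrow> C S \<inter> C T = {}"
    proof (intro ballI impI)
      fix S T assume ST: "S \<in> P" "T \<in> P" "S \<noteq> T"
      have "S \<inter> T = {}" using disjointD[OF P(2) ST] .
      moreover have "{} \<notin> C S"
        using ST(1) assms(4) unfolding conc by (auto simp: C_def)
      ultimately show "C S \<inter> C T = {}" unfolding C_def by blast
    qed
  qed
  also have "\<dots> = (\<Prod>S\<in>P. h (S - \<phi> -` R) * h (S - (S - \<phi> -` R)))"
  proof (rule prod.cong[OF refl])
    fix S assume "S \<in> P"
    then have "S - \<phi> -` R \<noteq> {}" using assms(4) unfolding conc by blast
    then have "S \<inter> \<phi> -` R \<noteq> S - \<phi> -` R" by blast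
    moreover have "S - (S - \<phi> -` R) = S \<inter> \<phi> -` R" by blast
    ultimately show "(\<Prod>T\<in>C S. h T) = h (S - \<phi> -` R) * h (S - (S - \<phi> -` R))"
      by (simp add: C_def mult.commute)
  qed
  finally show ?thesis .
qed

text \<open>
  Conclusiveness and the probability of a query both factor over the classes. With \<open>f = 1\<close> this
  gives the probability of a conclusive query, which is the normalisation of the conditioned law.
\<close>
lemma sum_conclusive_queries:
  fixes f :: "'a set \<Rightarrow> 'a set \<Rightarrow> real"
  assumes "finite X" "bij_betw \<phi> X A" "0 < p" "p < 1"
    and "partition_on X P" "\<And>S. S \<in> P \<Longrightarrow> 2 \<le> card S"
  shows "(\<Sum>R\<in>Pow A. if conclusive \<phi> P R
            then pmf (random_subset_pmf p A) R * (\<Prod>S\<in>P. f S (S - \<phi> -` R)) else 0) =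
    (\<Prod>S\<in>P. \<Sum>T\<in>Pow S. if T = {} \<or> T = S then 0
       else (\<Prod>x\<in>S. if x \<in> T then 1 - p else p) * f S T)"
proof -
  have A: "A = \<phi> ` X" "inj_on \<phi> X" "finite A" using assms(1,2) by (auto simp: bij_betw_def)
  have P: "\<Union>P = X" "disjoint P" using assms(5) by (auto simp: partition_on_def)
  have fin: "finite P" using finite_elements[OF assms(1,5)] .
  have finS: "finite S" if "S \<in> P" for S using finite_subset[OF Union_upper[OF that]] P(1) assms(1) by simp
  have conc: "conclusive \<phi> P R \<longleftrightarrow> (\<forall>S\<in>P. S - \<phi> -` R \<noteq> {} \<and> S - \<phi> -` R \<noteq> S)" for R
    by (rule conclusive_iff) (rule assms(6))
  define W where "W S T = (if T = {} \<or> T = S then 0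
      else (\<Prod>x\<in>S. if x \<in> T then 1 - p else p) * f S T)" for S T
  have "(\<Sum>R\<in>Pow A. if conclusive \<phi> P R
            then pmf (random_subset_pmf p A) R * (\<Prod>S\<in>P. f S (S - \<phi> -` R)) else 0) =
      (\<Sum>R\<in>Pow A. \<Prod>S\<in>P. W S (S \<inter> (X - \<phi> -` R)))"
  proof (rule sum.cong[OF refl])
    fix R assume R: "R \<in> Pow A"
    have ST: "S \<inter> (X - \<phi> -` R) = S - \<phi> -` R" if "S \<in> P" for S using that P(1) by auto
    have "pmf (random_subset_pmf p A) R = (\<Prod>x\<in>X. if \<phi> x \<in> R then p else 1 - p)"
      using pmf_random_subset_pmf[OF A(3) assms(3,4)] R by (simp add: A(1) prod.reindex[OF A(2)])
    also have "\<dots> = (\<Prod>S\<in>P. \<Prod>x\<in>S. if \<phi> x \<in> R then p else 1 - p)"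
      unfolding P(1)[symmetric] using P(2) finS
      by (subst prod.Union_disjoint) (auto simp: disjoint_def)
    also have "\<dots> = (\<Prod>S\<in>P. \<Prod>x\<in>S. if x \<in> S - \<phi> -` R then 1 - p else p)"
      by (intro prod.cong) auto
    finally have w: "pmf (random_subset_pmf p A) R = \<dots>" .
    show "(if conclusive \<phi> P R
            then pmf (random_subset_pmf p A) R * (\<Prod>S\<in>P. f S (S - \<phi> -` R)) else 0) =
        (\<Prod>S\<in>P. W S (S \<inter> (X - \<phi> -` R)))"
    proof (cases "conclusive \<phi> P R")
      case True
      then have "W S (S \<inter> (X - \<phi> -` R)) =
          (\<Prod>x\<in>S. if x \<in> S - \<phi> -` R then 1 - p else p) * f S (S - \<phi> -` R)" if "S \<in> P" for S
        using that unfolding ST[OF that] W_def conc by simp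
      then show ?thesis using True by (simp add: w prod.distrib)
    next
      case False
      then obtain S where "S \<in> P" "S - \<phi> -` R = {} \<or> S - \<phi> -` R = S"
        unfolding conc by blast
      then have "\<exists>S\<in>P. W S (S \<inter> (X - \<phi> -` R)) = 0" unfolding W_def by (metis ST)
      then show ?thesis using False fin by simp
    qed
  qed
  also have "\<dots> = (\<Sum>T\<in>Pow X. \<Prod>S\<in>P. W S (S \<inter> T))"
  proof (rule sum.reindex_bij_witness[where i = "\<lambda>T. \<phi> ` (X - T)" and j = "\<lambda>R. X - \<phi> -` R"])
    fix R assume "R \<in> Pow A"
    then show "\<phi> ` (X - (X - \<phi> -` R)) = R" using A(1) by auto
  next
    fix T assume "T \<in> Pow X"
    then show "X - \<phi> -` \<phi> ` (X - T) = T" using A(2) by (auto simp: inj_on_def)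
  qed (use A(1) in auto)
  also have "\<dots> = (\<Prod>S\<in>P. \<Sum>T\<in>Pow S. W S T)" by (rule sum_Pow_partition[OF assms(1,5)])
  finally show ?thesis by (simp add: W_def)
qed

lemma pmf_query_pmf:
  assumes "finite X" "bij_betw \<phi> X A" "0 < p" "p < 1" "partition_on X P"
  shows "pmf (query_pmf p A \<phi> P) R =
    (if conclusive \<phi> P R then pmf (random_subset_pmf p A) R /
       measure (measure_pmf (random_subset_pmf p A)) {R. conclusive \<phi> P R} else 0)"
proof -
  have A: "A = \<phi> ` X" "inj_on \<phi> X" "finite A" using assms(1,2) by (auto simp: bij_betw_def)
  have "\<exists>R\<subseteq>\<phi> ` X. conclusive \<phi> P R"
    using assms(5) A(2) by (intro conclusive_exists) (auto simp: partition_on_def)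
  then have "set_pmf (random_subset_pmf p A) \<inter> {R. conclusive \<phi> P R} \<noteq> {}"
    using set_random_subset_pmf[OF A(3) assms(3,4)] A(1) by auto
  then show ?thesis unfolding query_pmf_def by (simp add: pmf_cond)
qed

text \<open>
  One round of the process corresponds to one step of the recursion, in each class separately. If
  a singleton is already present, both sides vanish, because it stays; otherwise all classes are
  split.
\<close>
lemma (in split_bias) query_step:
  assumes "finite X" "bij_betw \<phi> X A" "partition_on X P"
  shows "(\<Sum>R\<in>Pow A. pmf (query_pmf p A \<phi> P) R *
            (\<Prod>S\<in>split_classes \<phi> P R. unrevealed k (card S))) =
    (\<Prod>S\<in>P. unrevealed (Suc k) (card S))"
proof (cases "\<exists>S\<in>P. card S = 1")
  case True
  then obtain S where S: "S \<in> P" "card S = 1" by blast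
  have fin: "finite P" using finite_elements[OF assms(1,3)] .
  have "(\<Prod>S\<in>split_classes \<phi> P R. unrevealed k (card S)) = 0" for R
  proof -
    have "S \<in> split_classes \<phi> P R" unfolding split_classes_def using S by force
    moreover have "finite (split_classes \<phi> P R)" unfolding split_classes_def using fin by simp
    ultimately show ?thesis using S(2) by (intro prod_zero) (auto intro!: bexI[of _ S])
  qed
  moreover have "(\<Prod>S\<in>P. unrevealed (Suc k) (card S)) = 0"
    using S fin by (intro prod_zero) (auto intro!: bexI[of _ S])
  ultimately show ?thesis by simp
next
  case False
  have P: "\<Union>P = X" "{} \<notin> P" using assms(3) by (auto simp: partition_on_def)
  have finS: "finite S" if "S \<in> P" for S using finite_subset[OF Union_upper[OF that]] P(1) assms(1) by simp
  have two: "2 \<le> card S" if "S \<in> P" for S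
  proof -
    have "card S \<noteq> 0" using that P(2) finS by auto
    moreover have "card S \<noteq> 1" using False that by blast
    ultimately show ?thesis by linarith
  qed
  have finA: "finite A" using assms(1,2) bij_betw_finite by blast
  define f where "f k m = (\<lambda>i. unrevealed k i * unrevealed k (m - i))" for k m
  define c where "c = (\<Prod>S\<in>P. 1 - p ^ card S - q ^ card S)"
  have c: "c \<noteq> 0" unfolding c_def using two split_prob_pos(2) finite_elements[OF assms(1,3)]
    by (auto simp: less_le)
  have q: "1 - p = q" using p_plus_q by simp
  have sum_queries: "(\<Sum>R\<in>Pow A. if conclusive \<phi> P R
        then pmf (random_subset_pmf p A) R * (\<Prod>S\<in>P. g S (S - \<phi> -` R)) else 0) =
      (\<Prod>S\<in>P. \<Sum>T\<in>Pow S. if T = {} \<or> T = S then 0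
         else (\<Prod>x\<in>S. if x \<in> T then q else p) * g S T)" for g
    unfolding q[symmetric] by (rule sum_conclusive_queries) (use assms p_pos p_lt_1 two in auto)
  have Z: "measure (measure_pmf (random_subset_pmf p A)) {R. conclusive \<phi> P R} = c"
  proof -
    have "measure (measure_pmf (random_subset_pmf p A)) {R. conclusive \<phi> P R} =
        measure (measure_pmf (random_subset_pmf p A)) {R \<in> Pow A. conclusive \<phi> P R}"
      using set_random_subset_pmf[OF finA p_pos p_lt_1]
      by (intro measure_prob_cong_0) (auto simp: pmf_eq_0_set_pmf)
    also have "\<dots> = (\<Sum>R | R \<in> Pow A \<and> conclusive \<phi> P R. pmf (random_subset_pmf p A) R)"
      using finA by (intro measure_measure_pmf_finite) simp
    also have "\<dots> = (\<Sum>R\<in>Pow A. if conclusive \<phi> P R then pmf (random_subset_pmf p A) R * (\<Prod>S\<in>P. 1) else 0)"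
      using finA by (simp flip: sum.inter_filter)
    also have "\<dots> = c"
      unfolding sum_queries[of "\<lambda>_ _. 1"] c_def
    proof (rule prod.cong[OF refl])
      fix S assume S: "S \<in> P"
      show "(\<Sum>T\<in>Pow S. if T = {} \<or> T = S then 0 else (\<Prod>x\<in>S. if x \<in> T then q else p) * 1) =
          1 - p ^ card S - q ^ card S"
        using sum_proper_subsets[OF finS[OF S] two[OF S], of "\<lambda>_. 1"]
        by (simp only: split_mean_const[OF two[OF S]] mult_1_right)
    qed
    finally show ?thesis .
  qed
  have "(\<Sum>R\<in>Pow A. pmf (query_pmf p A \<phi> P) R *
            (\<Prod>S\<in>split_classes \<phi> P R. unrevealed k (card S))) =
      (\<Sum>R\<in>Pow A. (if conclusive \<phi> P R then pmf (random_subset_pmf p A) R *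
          (\<Prod>S\<in>P. f k (card S) (card (S - \<phi> -` R))) else 0) / c)"
  proof (rule sum.cong[OF refl])
    fix R assume "R \<in> Pow A"
    have card_diff: "card (S - (S - \<phi> -` R)) = card S - card (S - \<phi> -` R)" if "S \<in> P" for S
      using finS[OF that] by (intro card_Diff_subset) auto
    show "pmf (query_pmf p A \<phi> P) R * (\<Prod>S\<in>split_classes \<phi> P R. unrevealed k (card S)) =
        (if conclusive \<phi> P R then pmf (random_subset_pmf p A) R *
          (\<Prod>S\<in>P. f k (card S) (card (S - \<phi> -` R))) else 0) / c"
      using prod_split_classes[OF assms(1,3) two, of \<phi> R "\<lambda>S. unrevealed k (card S)"]
      unfolding pmf_query_pmf[OF assms(1,2) p_pos p_lt_1 assms(3)] Z f_def
      by (simp add: card_diff)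
  qed
  also have "\<dots> = (\<Prod>S\<in>P. (1 - p ^ card S - q ^ card S) * split_mean (card S) (f k (card S))) / c"
    unfolding sum_divide_distrib[symmetric] sum_queries[of "\<lambda>S T. f k (card S) (card T)"]
    by (intro arg_cong2[where f = "(/)"] prod.cong refl) (simp add: sum_proper_subsets finS two)
  also have "\<dots> = (\<Prod>S\<in>P. split_mean (card S) (f k (card S)))"
    using c by (simp add: prod.distrib flip: c_def)
  also have "\<dots> = (\<Prod>S\<in>P. unrevealed (Suc k) (card S))"
  proof (rule prod.cong[OF refl])
    fix S assume "S \<in> P"
    then show "split_mean (card S) (f k (card S)) = unrevealed (Suc k) (card S)"
      using two[of S] by (auto simp: f_def)
  qed
  finally show ?thesis .
qed

section \<open>Singletons in the Renyi process\<close>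

sublocale renyi_process \<subseteq> split_bias p "1 - p"
  using bias by unfold_locales auto

context renyi_process begin

lemma query_eq_measurable:
  assumes "1 \<le> i"
  shows "{w \<in> space M. Q i w = R} \<in> events"
proof -
  have "Q i -` ({R} \<inter> Pow A) \<inter> space M \<in> events"
    by (rule measurable_sets[OF query_measurable[OF assms]]) simp
  moreover have "Q i -` ({R} \<inter> Pow A) \<inter> space M = {w \<in> space M. Q i w = R}"
    using measurable_space[OF query_measurable[OF assms]] by auto
  ultimately show ?thesis by simp
qed

lemma partition_event_measurable:
  "{w \<in> space M. good (renyi_partition X \<phi> (\<lambda>i. Q i w) k)} \<in> events"
proof -
  have "finite A" using bij finite_objects bij_betw_finite by blast
  then have "countable (Pow A)" by (intro countable_finite) simp
  then have "(\<lambda>w. renyi_partition X \<phi> (\<lambda>i. Q i w) k) \<in> measurable M (count_space (Pow (Pow X)))"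
    by (rule renyi_partition_measurable[OF finite_objects _ query_measurable])
  then have "(\<lambda>w. renyi_partition X \<phi> (\<lambda>i. Q i w) k) -` ({P. good P} \<inter> Pow (Pow X)) \<inter> space M \<in> events"
    by (rule measurable_sets) simp
  moreover have "renyi_partition X \<phi> (\<lambda>i. Q i w) k \<in> Pow (Pow X)" for w
    using renyi_partition_subset by blast
  then have "(\<lambda>w. renyi_partition X \<phi> (\<lambda>i. Q i w) k) -` ({P. good P} \<inter> Pow (Pow X)) \<inter> space M =
      {w \<in> space M. good (renyi_partition X \<phi> (\<lambda>i. Q i w) k)}" by auto
  ultimately show ?thesis by simp
qed

text \<open>
  The Markov property of the partition process: the probability of no singleton \<open>k\<close> rounds ahead
  depends on the history only through the current partition. The induction runs over the number of
  remaining rounds, for all histories at once, and sums over the value of the next query.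
\<close>
lemma prob_history_no_singleton:
  assumes "partition_on X (renyi_partition X \<phi> r j)"
  shows "prob {w \<in> space M. (\<forall>i\<in>{1..j}. Q i w = r i) \<and>
            (\<forall>S\<in>renyi_partition X \<phi> (\<lambda>i. Q i w) (j + k). card S \<noteq> 1)} =
    prob {w \<in> space M. \<forall>i\<in>{1..j}. Q i w = r i} *
      (\<Prod>S\<in>renyi_partition X \<phi> r j. unrevealed k (card S))"
  using assms
proof (induction k arbitrary: j r)
  case 0
  define P where "P = renyi_partition X \<phi> r j"
  have "finite P" using finite_elements[OF finite_objects 0] by (simp add: P_def)
  then have prod: "(\<Prod>S\<in>P. unrevealed 0 (card S)) = (if \<forall>S\<in>P. card S \<noteq> 1 then 1 else 0)"
    by auto
  have P: "renyi_partition X \<phi> (\<lambda>i. Q i w) j = P" if "\<forall>i\<in>{1..j}. Q i w = r i" for w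
    unfolding P_def using that by (intro renyi_partition_cong) auto
  then have "{w \<in> space M. (\<forall>i\<in>{1..j}. Q i w = r i) \<and>
        (\<forall>S\<in>renyi_partition X \<phi> (\<lambda>i. Q i w) (j + 0). card S \<noteq> 1)} =
      (if \<forall>S\<in>P. card S \<noteq> 1 then {w \<in> space M. \<forall>i\<in>{1..j}. Q i w = r i} else {})"
    by auto
  then show ?case unfolding P_def[symmetric] prod by auto
next
  case (Suc k)
  define P where "P = renyi_partition X \<phi> r j"
  define r' where "r' R = r(Suc j := R)" for R
  define H where "H j r = {w \<in> space M. \<forall>i\<in>{1..j}. Q i w = r i}" for j r
  define E where "E = {w \<in> space M. \<forall>S\<in>renyi_partition X \<phi> (\<lambda>i. Q i w) (j + Suc k). card S \<noteq> 1}"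
  have finA: "finite A" using bij finite_objects bij_betw_finite by blast
  have events: "H j r \<in> events" "E \<in> events" for j r
  proof -
    show "H j r \<in> events"
      unfolding H_def by (intro sets.sets_Collect_finite_All query_eq_measurable) auto
    show "E \<in> events" unfolding E_def by (rule partition_event_measurable)
  qed
  have P_r': "renyi_partition X \<phi> (r' R) (Suc j) = split_classes \<phi> P R" for R
  proof -
    have "renyi_partition X \<phi> (r' R) j = P"
      unfolding P_def r'_def by (rule renyi_partition_cong) auto
    then show ?thesis by (simp add: r'_def)
  qed
  have law: "prob (H (Suc j) (r' R)) = prob (H j r) * pmf (query_pmf p A \<phi> P) R" for R
  proof -
    have "{1..<Suc j} = {1..j}" by auto
    moreover have "renyi_partition X \<phi> (r' R) j = P"
      unfolding P_def r'_def by (rule renyi_partition_cong) auto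
    moreover have "{w \<in> space M. \<forall>i\<in>{1..j}. Q i w = r' R i} = H j r"
      unfolding H_def r'_def by auto
    ultimately show ?thesis
      using query_law[of "Suc j" "r' R"] by (simp add: H_def r'_def)
  qed
  have step: "prob (H (Suc j) (r' R) \<inter> E) = prob (H (Suc j) (r' R)) *
      (\<Prod>S\<in>split_classes \<phi> P R. unrevealed k (card S))" for R
  proof (cases "conclusive \<phi> P R")
    case True
    have "partition_on X (renyi_partition X \<phi> (r' R) (Suc j))"
      unfolding P_r' using Suc.prems True unfolding P_def[symmetric] by (rule partition_on_split_classes)
    note IH = Suc.IH[OF this]
    have "{w \<in> space M. (\<forall>i\<in>{1..Suc j}. Q i w = r' R i) \<and>
        (\<forall>S\<in>renyi_partition X \<phi> (\<lambda>i. Q i w) (Suc j + k). card S \<noteq> 1)} = H (Suc j) (r' R) \<inter> E"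
      unfolding H_def E_def add_Suc_shift by blast
    with IH show ?thesis unfolding P_r' by (simp only: H_def)
  next
    case False
    \<comment> \<open>an inconclusive query has probability \<open>0\<close>, so both sides vanish\<close>
    have "partition_on X P" using Suc.prems by (simp add: P_def)
    then have "pmf (query_pmf p A \<phi> P) R = 0"
      using pmf_query_pmf[OF finite_objects bij bias] False by simp
    then have "prob (H (Suc j) (r' R)) = 0" unfolding law by simp
    moreover have "prob (H (Suc j) (r' R) \<inter> E) \<le> prob (H (Suc j) (r' R))"
      using events by (intro finite_measure_mono) auto
    ultimately show ?thesis using measure_nonneg[of M "H (Suc j) (r' R) \<inter> E"] by simp
  qed
  have "{w \<in> space M. (\<forall>i\<in>{1..j}. Q i w = r i) \<and>
        (\<forall>S\<in>renyi_partition X \<phi> (\<lambda>i. Q i w) (j + Suc k). card S \<noteq> 1)} = H j r \<inter> E"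
    by (auto simp: H_def E_def)
  also have "\<dots> = (\<Union>R\<in>Pow A. H (Suc j) (r' R) \<inter> E)"
  proof -
    have "w \<in> (\<Union>R\<in>Pow A. H (Suc j) (r' R))" if "w \<in> H j r" for w
    proof
      show "Q (Suc j) w \<in> Pow A"
        using measurable_space[OF query_measurable[of "Suc j"]] that by (auto simp: H_def)
      show "w \<in> H (Suc j) (r' (Q (Suc j) w))"
        using that by (auto simp: H_def r'_def le_Suc_eq)
    qed
    moreover have "H (Suc j) (r' R) \<subseteq> H j r" for R
    proof
      fix w assume w: "w \<in> H (Suc j) (r' R)"
      have "Q i w = r i" if "i \<in> {1..j}" for i
      proof -
        have "Q i w = r' R i" using w that by (simp add: H_def)
        then show ?thesis using that by (simp add: r'_def)
      qed
      then show "w \<in> H j r" using w by (simp add: H_def)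
    qed
    ultimately show ?thesis by blast
  qed
  also have "prob \<dots> = (\<Sum>R\<in>Pow A. prob (H (Suc j) (r' R) \<inter> E))"
  proof (rule finite_measure_finite_Union)
    have "R = R'" if "w \<in> H (Suc j) (r' R)" "w \<in> H (Suc j) (r' R')" for R R' w
    proof -
      have "Q (Suc j) w = r' R (Suc j)" "Q (Suc j) w = r' R' (Suc j)"
        using that by (simp_all add: H_def)
      then show ?thesis by (simp add: r'_def)
    qed
    then show "disjoint_family_on (\<lambda>R. H (Suc j) (r' R) \<inter> E) (Pow A)"
      unfolding disjoint_family_on_def by blast
  qed (use finA events in auto)
  also have "\<dots> = prob (H j r) * (\<Sum>R\<in>Pow A. pmf (query_pmf p A \<phi> P) R *
      (\<Prod>S\<in>split_classes \<phi> P R. unrevealed k (card S)))"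
    unfolding step law sum_distrib_left by (simp add: mult_ac)
  also have "(\<Sum>R\<in>Pow A. pmf (query_pmf p A \<phi> P) R *
      (\<Prod>S\<in>split_classes \<phi> P R. unrevealed k (card S))) = (\<Prod>S\<in>P. unrevealed (Suc k) (card S))"
    using Suc.prems unfolding P_def[symmetric] by (rule query_step[OF finite_objects bij])
  finally show ?case by (simp only: H_def P_def)
qed

lemma prob_no_singleton:
  assumes "1 \<le> card X"
  shows "prob {w \<in> space M. \<forall>S\<in>renyi_partition X \<phi> (\<lambda>i. Q i w) k. card S \<noteq> 1} =
    unrevealed k (card X)"
proof -
  have "partition_on X (renyi_partition X \<phi> (\<lambda>_. {}) 0)"
    using assms by (auto simp: partition_on_def)
  from prob_history_no_singleton[OF this, of k] show ?thesis by (simp add: prob_space)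
qed

text \<open>
  If there is no singleton after \<open>K1\<close> queries but one after \<open>K2 + 1\<close> queries, the first one
  appears with a query whose number is in \<open>K1 + 1, \<dots>, K2 + 1\<close>, and the fillup level is one less.
  The existence of some singleton is part of the argument, as otherwise the least index would be
  arbitrary.
\<close>
lemma prob_fillup_level_outside:
  assumes "1 \<le> card X" "lo \<le> real K1" "real K2 \<le> hi"
  shows "prob {w \<in> space M. real_of_int (fillup_level X \<phi> (\<lambda>j. Q j w)) < lo \<or>
                 hi < real_of_int (fillup_level X \<phi> (\<lambda>j. Q j w))} \<le>
    (1 - unrevealed K1 (card X)) + unrevealed (Suc K2) (card X)"
proof -
  define N where "N k = {w \<in> space M. \<forall>S\<in>renyi_partition X \<phi> (\<lambda>i. Q i w) k. card S \<noteq> 1}" for k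
  have N_events: "N k \<in> events" for k unfolding N_def by (rule partition_event_measurable)
  have N_prob: "prob (N k) = unrevealed k (card X)" for k
    unfolding N_def by (rule prob_no_singleton[OF assms(1)])
  have between: "lo \<le> real_of_int (fillup_level X \<phi> (\<lambda>j. Q j w)) \<and>
      real_of_int (fillup_level X \<phi> (\<lambda>j. Q j w)) \<le> hi"
    if w: "w \<in> space M" "w \<in> N K1" "w \<notin> N (Suc K2)" for w
  proof -
    define P where "P k = renyi_partition X \<phi> (\<lambda>j. Q j w) k" for k
    define B where "B k = external_profile X \<phi> (\<lambda>j. Q j w) k" for k
    have stays: "{x} \<in> P (Suc k)" if "{x} \<in> P k" for x k
      using that unfolding P_def by (force simp: split_classes_def)
    have keep: "{x} \<in> P k" if "{x} \<in> P j" "j \<le> k" for x j k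
      using that(2,1) by (induction rule: dec_induct) (auto intro: stays)
    have in_X: "x \<in> X" if "{x} \<in> P k" for x k
      using renyi_partition_subset that unfolding P_def by fast
    have B: "B k > 0 \<longleftrightarrow> (\<exists>x. {x} \<in> P k \<and> (k = 0 \<or> {x} \<notin> P (k - 1)))" for k
      using in_X finite_objects unfolding B_def external_profile_def P_def[symmetric]
      by (auto simp: card_gt_0_iff)
    obtain x where x: "{x} \<in> P (Suc K2)"
    proof -
      have "\<exists>S\<in>P (Suc K2). card S = 1" using w(1,3) unfolding N_def P_def by blast
      then show ?thesis using that by (metis card_1_singletonE)
    qed
    define j where "j = (LEAST j. {x} \<in> P j)"
    have j: "{x} \<in> P j" "j \<le> Suc K2" unfolding j_def using x by (auto intro: LeastI Least_le)
    have "j = 0 \<or> {x} \<notin> P (j - 1)"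
      using not_less_Least[of "j - 1" "\<lambda>j. {x} \<in> P j"] unfolding j_def[symmetric] by (cases j) auto
    then have Bj: "B j > 0" using j(1) unfolding B by blast
    define F where "F = (LEAST k. B k > 0)"
    have F: "B F > 0" "F \<le> j" unfolding F_def using Bj by (auto intro: LeastI Least_le)
    then obtain y where y: "{y} \<in> P F" unfolding B by blast
    have "K1 < F"
    proof (rule ccontr)
      assume "\<not> K1 < F"
      then have "{y} \<in> P K1" using keep[OF y] by simp
      then have "card {y} \<noteq> 1" using w(2) unfolding N_def P_def by blast
      then show False by simp
    qed
    moreover have "F \<le> Suc K2" using F(2) j(2) by simp
    moreover have "fillup_level X \<phi> (\<lambda>j. Q j w) = int F - 1"
      by (simp add: fillup_level_def F_def B_def)
    ultimately show ?thesis using assms(2,3) by auto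
  qed
  have "prob {w \<in> space M. real_of_int (fillup_level X \<phi> (\<lambda>j. Q j w)) < lo \<or>
                 hi < real_of_int (fillup_level X \<phi> (\<lambda>j. Q j w))} \<le>
      prob ((space M - N K1) \<union> N (Suc K2))"
    using between N_events by (intro finite_measure_mono) (force simp: not_less)+
  also have "\<dots> \<le> prob (space M - N K1) + prob (N (Suc K2))"
    using N_events by (intro measure_Un_le) auto
  also have "\<dots> = (1 - unrevealed K1 (card X)) + unrevealed (Suc K2) (card X)"
    using prob_compl[OF N_events] by (simp add: N_prob)
  finally show ?thesis .
qed

end

section \<open>Asymptotics of the fillup level\<close>

context split_bias begin

text \<open>
  After \<open>log\<^bsub>1/q\<^esub> n - log\<^bsub>1/q\<^esub> w\<close> rounds the quantity \<open>n q\<^sup>k\<close> equals \<open>w\<close>, which is why the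
  centring has this form; a shift by \<open>\<epsilon> ln w\<close> multiplies it by a power of \<open>w\<close>.
\<close>
lemma mult_powr_log:
  assumes "0 < w" "0 < n"
  shows "n * q powr (log (1/q) n - log (1/q) w + t) = w * q powr t"
proof -
  have "ln q < 0" using q_pos q_lt_1 by simp
  then have "(log (1/q) n - log (1/q) w + t) * ln q = ln w - ln n + t * ln q"
    using q_pos by (simp add: log_def ln_div field_simps)
  then show ?thesis
    using assms q_pos by (simp add: powr_def exp_add exp_diff)
qed

lemma powr_mult_ln:
  assumes "0 < w"
  shows "q powr (t * ln w) = w powr (- t * ln (1/q))"
  using assms q_pos by (simp add: powr_def ln_div mult_ac)

lemma ln_inv_q_pos: "0 < ln (1/q)"
  using q_pos q_lt_1 by simp

lemma revealed_le_before:
  fixes n :: nat and w \<epsilon> x y :: real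
  assumes "q \<le> p" "1 \<le> n" "1 \<le> w" "0 \<le> \<epsilon>" "0 \<le> x"
    and x: "x = log (1/q) n - log (1/q) w - \<epsilon> * ln w"
    and y: "y = q / 2 * w powr (1 + \<epsilon> * ln (1/q))"
  shows "real (nat \<lceil>x\<rceil>) \<le> ln n / ln (1/q) + 1"
    and "1 - unrevealed (nat \<lceil>x\<rceil>) n \<le> 2 * (exp (- y) * (1 + exp (- (p / q - 1) * y)) ^ nat \<lceil>x\<rceil>)"
proof -
  define K where "K = nat \<lceil>x\<rceil>"
  have K: "real K \<le> x + 1" using assms(5) unfolding K_def by linarith
  have "x \<le> ln n / ln (1/q)"
  proof -
    have "0 \<le> log (1/q) w" "0 \<le> \<epsilon> * ln w"
      using assms(3,4) q_pos q_lt_1 by (simp_all add: zero_le_log_cancel_iff)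
    then show ?thesis unfolding x by (simp add: log_def)
  qed
  then show "real (nat \<lceil>x\<rceil>) \<le> ln n / ln (1/q) + 1" using K unfolding K_def by simp
  have "q * w powr (1 + \<epsilon> * ln (1/q)) = w * q powr (- \<epsilon> * ln w + 1)"
    using powr_mult_ln[of w "- \<epsilon>"] assms(3) q_pos unfolding powr_add by simp
  also have "\<dots> = n * q powr (log (1/q) n - log (1/q) w + (- \<epsilon> * ln w + 1))"
    using assms(2,3) by (intro mult_powr_log[symmetric]) auto
  also have "\<dots> = n * q powr (x + 1)" unfolding x by (simp add: algebra_simps)
  also have "\<dots> \<le> n * q powr (real K)"
    using K q_pos q_lt_1 by (intro mult_left_mono powr_mono') auto
  also have "\<dots> = n * q ^ K" using q_pos by (simp add: powr_realpow)
  finally have "y \<le> real n * (1/2) * q ^ K" unfolding y by simp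
  then have "leaf_sum (1/2) K n \<le> exp (- y) * (1 + exp (- (p / q - 1) * y)) ^ K"
    using assms(1) by (intro leaf_sum_le_exp) auto
  then show "1 - unrevealed (nat \<lceil>x\<rceil>) n \<le> 2 * (exp (- y) * (1 + exp (- (p / q - 1) * y)) ^ nat \<lceil>x\<rceil>)"
    using revealed_le_leaf_sum[OF assms(2), of K] unfolding K_def by linarith
qed

lemma mean_class_size_after:
  fixes n :: nat and w \<epsilon> x :: real
  assumes "1 \<le> n" "1 \<le> w" "0 \<le> x"
    and x: "x = log (1/q) n - log (1/q) w + \<epsilon> * ln w"
  shows "real n * q ^ nat \<lfloor>x\<rfloor> \<le> w powr (1 - \<epsilon> * ln (1/q)) / q"
proof -
  define K where "K = nat \<lfloor>x\<rfloor>"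
  have K: "x - 1 \<le> real K" using assms(3) unfolding K_def by linarith
  have "n * q ^ K = n * q powr (real K)" using q_pos by (simp add: powr_realpow)
  also have "\<dots> \<le> n * q powr (x - 1)"
    using K q_pos q_lt_1 by (intro mult_left_mono powr_mono') auto
  also have "\<dots> = n * q powr (log (1/q) n - log (1/q) w + (\<epsilon> * ln w - 1))"
    unfolding x by (simp add: algebra_simps)
  also have "\<dots> = w * q powr (\<epsilon> * ln w - 1)"
    using assms(1,2) by (intro mult_powr_log) auto
  also have "\<dots> = w powr (1 - \<epsilon> * ln (1/q)) / q"
    using assms(2) q_pos by (simp add: powr_diff powr_mult_ln powr_minus field_simps)
  finally show ?thesis unfolding K_def .
qed

text \<open>
  With \<open>w = ln (ln n)\<close>, the number of rounds is of order \<open>ln n = e\<^sup>w\<close>. A factor \<open>1 + e\<^bsup>-\<rho>y\<^esup>\<close> per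
  round stays harmless because \<open>y\<close> is of larger order than \<open>w\<close>.
\<close>
lemma tendsto_revealed_biased:
  assumes "q < p" "0 < \<epsilon>"
  shows "(\<lambda>n. 1 - unrevealed (nat \<lceil>log (1/q) (real n) - log (1/q) (ln (ln (real n))) -
           \<epsilon> * ln (ln (ln (real n)))\<rceil>) n) \<longlonglongrightarrow> 0"
proof -
  define l where "l = ln (1/q)"
  define \<eta> where "\<eta> = \<epsilon> * l"
  define \<rho> where "\<rho> = p / q - 1"
  have l: "0 < l" unfolding l_def by (rule ln_inv_q_pos)
  have pos: "0 < q / 2" "0 < \<eta>" "0 < \<rho>"
    using l assms q_pos by (simp_all add: \<eta>_def \<rho>_def)
  define x where "x n = log (1/q) (real n) - log (1/q) (ln (ln (real n))) - \<epsilon> * ln (ln (ln (real n)))" for n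
  define y where "y n = q / 2 * ln (ln (real n)) powr (1 + \<eta>)" for n
  define u where "u n = 2 * exp (- y n + (ln (real n) / l + 1) * exp (- \<rho> * y n))" for n
  have u: "u \<longlonglongrightarrow> 0"
    unfolding u_def y_def using l pos by real_asymp
  have "\<forall>\<^sub>F n in sequentially. 1 \<le> ln (ln (real n))" "\<forall>\<^sub>F n::nat in sequentially. 1 \<le> n"
    by real_asymp+
  moreover have "\<forall>\<^sub>F n in sequentially. 0 \<le> x n"
    unfolding x_def log_def l_def[symmetric] using l assms(2) by real_asymp
  ultimately have "\<forall>\<^sub>F n in sequentially. 0 \<le> 1 - unrevealed (nat \<lceil>x n\<rceil>) n \<and> 1 - unrevealed (nat \<lceil>x n\<rceil>) n \<le> u n"
  proof eventually_elim
    case (elim n)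
    define K where "K = nat \<lceil>x n\<rceil>"
    have K: "real K \<le> ln n / l + 1"
      and le: "1 - unrevealed K n \<le> 2 * (exp (- y n) * (1 + exp (- \<rho> * y n)) ^ K)"
      using revealed_le_before[of n "ln (ln (real n))" \<epsilon> "x n" "y n"] elim assms
      unfolding K_def l_def \<rho>_def x_def y_def \<eta>_def by auto
    have "(1 + exp (- \<rho> * y n)) ^ K \<le> exp (exp (- \<rho> * y n)) ^ K"
      by (intro power_mono exp_ge_add_one_self) (auto intro: add_nonneg_nonneg)
    also have "\<dots> = exp (real K * exp (- \<rho> * y n))" by (simp add: exp_of_nat_mult)
    also have "\<dots> \<le> exp ((ln n / l + 1) * exp (- \<rho> * y n))"
      using K by (simp add: mult_right_mono)
    finally have "2 * (exp (- y n) * (1 + exp (- \<rho> * y n)) ^ K) \<le> u n"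
      unfolding u_def exp_add by (intro mult_left_mono) auto
    then show ?case using le unrevealed_bounds(2)[OF elim(2), of K] unfolding K_def by simp
  qed
  then have "(\<lambda>n. 1 - unrevealed (nat \<lceil>x n\<rceil>) n) \<longlonglongrightarrow> 0"
    by (intro tendsto_sandwich[OF _ _ tendsto_const u]) (auto elim: eventually_mono)
  then show ?thesis by (simp add: x_def)
qed

text \<open>
  For \<open>p = q\<close> all \<open>2\<^sup>k\<close> words have the same probability, so \<open>y\<close> has to beat \<open>k ln 2\<close>, which is of
  order \<open>ln n\<close>.
\<close>
lemma tendsto_revealed_unbiased:
  assumes "p = q" "0 < \<epsilon>"
  shows "(\<lambda>n. 1 - unrevealed (nat \<lceil>log (1/q) (real n) - log (1/q) (ln (real n)) -
           \<epsilon> * ln (ln (real n))\<rceil>) n) \<longlonglongrightarrow> 0"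
proof -
  define l where "l = ln (1/q)"
  define \<eta> where "\<eta> = \<epsilon> * l"
  have l: "0 < l" unfolding l_def by (rule ln_inv_q_pos)
  have pos: "0 < q / 2" "0 < \<eta>"
    using l assms q_pos by (simp_all add: \<eta>_def)
  define x where "x n = log (1/q) (real n) - log (1/q) (ln (real n)) - \<epsilon> * ln (ln (real n))" for n
  define y where "y n = q / 2 * ln (real n) powr (1 + \<eta>)" for n
  define u where "u n = 2 * exp (- y n + (ln (real n) / l + 1) * ln 2)" for n
  have u: "u \<longlonglongrightarrow> 0"
    unfolding u_def y_def using l pos by real_asymp
  have "\<forall>\<^sub>F n in sequentially. 1 \<le> ln (real n)" "\<forall>\<^sub>F n::nat in sequentially. 1 \<le> n"
    by real_asymp+
  moreover have "\<forall>\<^sub>F n in sequentially. 0 \<le> x n"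
    unfolding x_def log_def l_def[symmetric] using l assms(2) by real_asymp
  ultimately have "\<forall>\<^sub>F n in sequentially. 0 \<le> 1 - unrevealed (nat \<lceil>x n\<rceil>) n \<and> 1 - unrevealed (nat \<lceil>x n\<rceil>) n \<le> u n"
  proof eventually_elim
    case (elim n)
    define K where "K = nat \<lceil>x n\<rceil>"
    have K: "real K \<le> ln n / l + 1"
      and le: "1 - unrevealed K n \<le> 2 * (exp (- y n) * 2 ^ K)"
      using revealed_le_before[of n "ln (real n)" \<epsilon> "x n" "y n"] elim assms q_pos
      unfolding K_def l_def x_def y_def \<eta>_def by auto
    have "(2::real) ^ K = exp (real K * ln 2)" by (simp add: exp_of_nat_mult)
    also have "\<dots> \<le> exp ((ln n / l + 1) * ln 2)"
      using K by (simp add: mult_right_mono)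
    finally have "2 * (exp (- y n) * 2 ^ K) \<le> u n"
      unfolding u_def exp_add by (intro mult_left_mono) auto
    then show ?case using le unrevealed_bounds(2)[OF elim(2), of K] unfolding K_def by simp
  qed
  then have "(\<lambda>n. 1 - unrevealed (nat \<lceil>x n\<rceil>) n) \<longlonglongrightarrow> 0"
    by (intro tendsto_sandwich[OF _ _ tendsto_const u]) (auto elim: eventually_mono)
  then show ?thesis by (simp add: x_def)
qed

text \<open>
  The threshold \<open>L = w\<^sup>\<beta>\<close> lies strictly between \<open>n q\<^sup>k\<close>, which is of order at most \<open>w\<^bsup>1 - 2\<theta>\<^esup>\<close>,
  and \<open>w\<close>. The first comparison makes Markov's error small, the second makes \<open>e\<^bsup>-2L\<^esup>\<close> much larger
  than the reciprocal of the number of rounds.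
\<close>
lemma tendsto_unrevealed_biased:
  assumes "q < p" "0 < \<epsilon>"
  shows "(\<lambda>n. unrevealed (Suc (nat \<lfloor>log (1/q) (real n) - log (1/q) (ln (ln (real n))) +
           \<epsilon> * ln (ln (ln (real n)))\<rfloor>)) n) \<longlonglongrightarrow> 0"
proof -
  define l where "l = ln (1/q)"
  have l: "0 < l" unfolding l_def by (rule ln_inv_q_pos)
  \<comment> \<open>half of the exponent gained, capped so that \<open>1 - 2 * \<theta>\<close> and \<open>\<beta>\<close> stay positive\<close>
  define \<theta> where "\<theta> = min (\<epsilon> * l) (1/2) / 2"
  define \<beta> where "\<beta> = 1 - \<theta>"
  have \<theta>: "0 < \<theta>" "0 < \<beta>" "\<beta> < 1" "2 * \<theta> \<le> \<epsilon> * l"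
    using l assms(2) by (auto simp: \<theta>_def \<beta>_def min_def)
  define D where "D = 1 / (2 * p * q)"
  have D: "0 < D" using p_pos q_pos by (simp add: D_def)
  define w where "w n = ln (ln (real n))" for n
  define x where "x n = log (1/q) (real n) - log (1/q) (w n) + \<epsilon> * ln (w n)" for n
  define u where "u n =
    exp (- (q * exp (- 2 * w n powr \<beta>) * ((ln (real n) - ln (w n)) / l - 1))) +
    (w n powr (- \<theta>) / q + D * w n powr (- \<beta>))" for n
  have "(\<lambda>n::nat. exp (- (q * exp (- 2 * ln (ln (real n)) powr \<beta>) *
      ((ln (real n) - ln (ln (ln (real n)))) / l - 1)))) \<longlonglongrightarrow> 0"
    using l \<theta> q_pos by real_asymp
  moreover have "(\<lambda>n::nat. ln (ln (real n)) powr (- \<theta>) / q + D * ln (ln (real n)) powr (- \<beta>)) \<longlonglongrightarrow> 0"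
  proof (intro tendsto_add_zero tendsto_divide_zero tendsto_mult_right_zero)
    show "(\<lambda>n::nat. ln (ln (real n)) powr (- \<theta>)) \<longlonglongrightarrow> 0"
      using \<theta>(1) by real_asymp
    show "(\<lambda>n::nat. ln (ln (real n)) powr (- \<beta>)) \<longlonglongrightarrow> 0"
      using \<theta>(2) by real_asymp
  qed
  ultimately have u: "u \<longlonglongrightarrow> 0"
    unfolding u_def w_def by (rule tendsto_add_zero)
  have "\<forall>\<^sub>F n in sequentially. 1 \<le> w n" "\<forall>\<^sub>F n::nat in sequentially. 1 \<le> n"
    unfolding w_def by real_asymp+
  moreover have "\<forall>\<^sub>F n in sequentially. 0 \<le> x n"
    unfolding x_def w_def log_def l_def[symmetric] using l assms(2) by real_asymp
  ultimately have "\<forall>\<^sub>F n in sequentially. 0 \<le> unrevealed (Suc (nat \<lfloor>x n\<rfloor>)) n \<and> unrevealed (Suc (nat \<lfloor>x n\<rfloor>)) n \<le> u n"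
  proof eventually_elim
    case (elim n)
    define K where "K = nat \<lfloor>x n\<rfloor>"
    define L where "L = w n powr \<beta>"
    have L: "1 \<le> L" unfolding L_def using elim(1) \<theta> by (intro ge_one_powr_ge_zero) auto
    have "q * exp (- 2 * L) \<le> 1 * 1"
      using q_pos q_lt_1 L by (intro mult_mono) auto
    then have "(1 - q * exp (- 2 * L)) ^ K \<le> exp (- (q * exp (- 2 * L))) ^ K"
      using exp_ge_add_one_self[of "- (q * exp (- 2 * L))"] by (intro power_mono) auto
    also have "\<dots> = exp (- (q * exp (- 2 * L) * real K))"
      by (simp add: exp_of_nat_mult[symmetric] mult_ac)
    also have "\<dots> \<le> exp (- (q * exp (- 2 * L) * ((ln (real n) - ln (w n)) / l - 1)))"
    proof -
      have "0 \<le> \<epsilon> * ln (w n)" using assms(2) elim(1) by simp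
      then have "(ln (real n) - ln (w n)) / l \<le> x n"
        unfolding x_def log_def l_def by (simp add: diff_divide_distrib)
      moreover have "x n - 1 \<le> real K" unfolding K_def using elim(3) by linarith
      ultimately show ?thesis using q_pos by (simp add: mult_left_mono)
    qed
    finally have 1: "(1 - q * exp (- 2 * L)) ^ K \<le> \<dots>" .
    have "real n * q ^ K \<le> w n powr (1 - \<epsilon> * l) / q"
      using mean_class_size_after[of n "w n" "x n" \<epsilon>] elim
      unfolding K_def x_def l_def by simp
    also have "\<dots> \<le> w n powr (1 - 2 * \<theta>) / q"
      using elim(1) \<theta>(4) q_pos by (intro divide_right_mono powr_mono) auto
    finally have "(real n * q ^ K + D) / L \<le> (w n powr (1 - 2 * \<theta>) / q + D) / L"
      using L by (intro divide_right_mono add_right_mono) auto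
    also have "\<dots> = w n powr (- \<theta>) / q + D * w n powr (- \<beta>)"
    proof -
      have "w n powr (1 - 2 * \<theta>) = w n powr (- \<theta>) * L"
        unfolding L_def \<beta>_def by (simp flip: powr_add)
      moreover have "w n powr (- \<beta>) = 1 / L"
        unfolding L_def by (simp add: powr_minus inverse_eq_divide)
      ultimately show ?thesis using L q_pos by (simp only:) (simp add: field_simps)
    qed
    finally have 2: "(real n * q ^ K + D) / L \<le> \<dots>" .
    have "unrevealed (Suc K) n \<le> u n"
      using unrevealed_le_spine[OF less_imp_le[OF assms(1)] elim(2) L, of K] 1 2
      unfolding u_def D_def[symmetric] L_def by linarith
    then show ?case using unrevealed_bounds(1)[OF elim(2), of "Suc K"] unfolding K_def by simp
  qed
  then have "(\<lambda>n. unrevealed (Suc (nat \<lfloor>x n\<rfloor>)) n) \<longlonglongrightarrow> 0"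
    by (intro tendsto_sandwich[OF _ _ tendsto_const u]) (auto elim: eventually_mono)
  then show ?thesis by (simp add: x_def w_def)
qed

text \<open>
  All but the last of the rounds serve to create many classes, and only the last one is asked to
  produce a singleton. With \<open>s = 2 L\<close>, where \<open>L\<close> bounds the mean class size \<open>n / 2\<^sup>k\<close>, at least
  half of the \<open>2\<^sup>k\<close> classes have size at most \<open>s\<close>, and \<open>2\<^sup>k e\<^bsup>-2L\<^esup>\<close> tends to infinity because \<open>L\<close>
  is of smaller order than \<open>ln n\<close>.
\<close>
lemma tendsto_unrevealed_unbiased:
  assumes "p = q" "0 < \<epsilon>"
  shows "(\<lambda>n. unrevealed (Suc (nat \<lfloor>log (1/q) (real n) - log (1/q) (ln (real n)) +
           \<epsilon> * ln (ln (real n))\<rfloor>)) n) \<longlonglongrightarrow> 0"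
proof -
  define l where "l = ln (1/q)"
  have l: "0 < l" unfolding l_def by (rule ln_inv_q_pos)
  have q: "q = 1/2" using assms(1) p_plus_q by simp
  define \<beta> where "\<beta> = 1 - min (\<epsilon> * l) (1/2)"
  have \<beta>: "0 < \<beta>" "\<beta> < 1" "1 - \<epsilon> * l \<le> \<beta>"
    using l assms(2) by (auto simp: \<beta>_def min_def)
  define L where "L n = 2 * ln (real n) powr \<beta>" for n
  define x where "x n = log (1/q) (real n) - log (1/q) (ln (real n)) + \<epsilon> * ln (ln (real n))" for n
  define u where "u n = exp (- (1/2 * exp (- 2 * L n) * (real n / (2 * L n))))" for n
  have u: "u \<longlonglongrightarrow> 0"
    unfolding u_def L_def using \<beta> by real_asymp
  have "\<forall>\<^sub>F n in sequentially. 1 \<le> ln (real n)" "\<forall>\<^sub>F n::nat in sequentially. 1 \<le> n"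
    by real_asymp+
  moreover have "\<forall>\<^sub>F n in sequentially. 0 \<le> x n"
    unfolding x_def log_def l_def[symmetric] using l assms(2) by real_asymp
  ultimately have "\<forall>\<^sub>F n in sequentially. 0 \<le> unrevealed (Suc (nat \<lfloor>x n\<rfloor>)) n \<and> unrevealed (Suc (nat \<lfloor>x n\<rfloor>)) n \<le> u n"
  proof eventually_elim
    case (elim n)
    define K where "K = nat \<lfloor>x n\<rfloor>"
    define d where "d = q * exp (- 2 * L n)"
    have "1 \<le> ln (real n) powr \<beta>" using elim(1) \<beta> by (intro ge_one_powr_ge_zero) auto
    then have L: "1 \<le> L n" unfolding L_def by simp
    have d: "0 < d" "d \<le> 1/2" using L by (simp_all add: d_def q)
    have "real n * q ^ K \<le> ln (real n) powr (1 - \<epsilon> * l) / q"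
      using mean_class_size_after[of n "ln (real n)" "x n" \<epsilon>] elim
      unfolding K_def x_def l_def by simp
    also have "\<dots> \<le> L n"
      unfolding L_def q using elim(1) \<beta>(3) by (simp add: powr_mono)
    finally have nK: "real n / L n \<le> 2 ^ K"
      using L unfolding q by (simp add: field_simps power_divide)
    have "unrevealed (K + 1) n \<le> (1 - d) powr (2 ^ K - real n / (2 * L n))"
    proof (rule unrevealed_le_powr)
      fix i :: nat assume i: "1 \<le> i" "real i \<le> 2 * L n"
      have "real i * q ^ 1 \<le> L n" using i(2) by (simp add: q)
      then show "unrevealed 1 i \<le> 1 - d"
        unfolding d_def using i(1) L assms(1) by (intro unrevealed_le) auto
    qed (use d L elim(2) in auto)
    also have "\<dots> \<le> (1 - d) powr (real n / (2 * L n))"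
      using d nK by (intro powr_mono') (auto simp: field_simps)
    also have "\<dots> \<le> exp (- d) powr (real n / (2 * L n))"
      using d L exp_ge_add_one_self[of "- d"] by (intro powr_mono2) auto
    also have "\<dots> = u n" by (simp add: u_def d_def powr_def q)
    finally show ?case using unrevealed_bounds(1)[OF elim(2), of "Suc K"] unfolding K_def by simp
  qed
  then have "(\<lambda>n. unrevealed (Suc (nat \<lfloor>x n\<rfloor>)) n) \<longlonglongrightarrow> 0"
    by (intro tendsto_sandwich[OF _ _ tendsto_const u]) (auto elim: eventually_mono)
  then show ?thesis by (simp add: x_def)
qed

end

lemma whp_eq_up_to_fillup_level:
  fixes F :: "nat \<Rightarrow> 'w \<Rightarrow> real"
  assumes process: "\<And>n. renyi_process p (X n) (A n) (\<phi> n) (M n) (Q n)"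
    and card: "\<And>n. card (X n) = n"
    and F: "\<And>n w. F n w = of_int (fillup_level (X n) (\<phi> n) (\<lambda>j. Q n j w))"
    and nonneg: "\<And>\<epsilon>. 0 < \<epsilon> \<Longrightarrow> \<forall>\<^sub>F n in sequentially. 0 \<le> a n + \<epsilon> * b n"
    and before: "\<And>\<epsilon>. 0 < \<epsilon> \<Longrightarrow>
      (\<lambda>n. 1 - split_bias.unrevealed p (1 - p) (nat \<lceil>a n - \<epsilon> * b n\<rceil>) n) \<longlonglongrightarrow> 0"
    and after: "\<And>\<epsilon>. 0 < \<epsilon> \<Longrightarrow>
      (\<lambda>n. split_bias.unrevealed p (1 - p) (Suc (nat \<lfloor>a n + \<epsilon> * b n\<rfloor>)) n) \<longlonglongrightarrow> 0"
  shows "whp_eq_up_to M F a b"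
  unfolding whp_eq_up_to_def
proof (intro allI impI)
  fix \<epsilon> :: real assume \<epsilon>: "0 < \<epsilon>"
  define u where "u n =
    (1 - split_bias.unrevealed p (1 - p) (nat \<lceil>a n - \<epsilon> * b n\<rceil>) n) +
    split_bias.unrevealed p (1 - p) (Suc (nat \<lfloor>a n + \<epsilon> * b n\<rfloor>)) n" for n
  have u: "u \<longlonglongrightarrow> 0"
    unfolding u_def using before[OF \<epsilon>] after[OF \<epsilon>] by (rule tendsto_add_zero)
  have "\<forall>\<^sub>F n in sequentially.
      measure (M n) {w \<in> space (M n). \<epsilon> * b n < \<bar>F n w - a n\<bar>} \<le> u n"
    using nonneg[OF \<epsilon>] eventually_ge_at_top[of 1]
  proof eventually_elim
    case (elim n)
    have "{w \<in> space (M n). \<epsilon> * b n < \<bar>F n w - a n\<bar>} =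
        {w \<in> space (M n). real_of_int (fillup_level (X n) (\<phi> n) (\<lambda>j. Q n j w)) < a n - \<epsilon> * b n \<or>
           a n + \<epsilon> * b n < real_of_int (fillup_level (X n) (\<phi> n) (\<lambda>j. Q n j w))}"
      unfolding F by auto
    moreover have "a n - \<epsilon> * b n \<le> real (nat \<lceil>a n - \<epsilon> * b n\<rceil>)" by linarith
    moreover have "real (nat \<lfloor>a n + \<epsilon> * b n\<rfloor>) \<le> a n + \<epsilon> * b n" using elim(1) by linarith
    ultimately show ?case
      using renyi_process.prob_fillup_level_outside[OF process, of n "a n - \<epsilon> * b n"
          "nat \<lceil>a n - \<epsilon> * b n\<rceil>" "nat \<lfloor>a n + \<epsilon> * b n\<rfloor>" "a n + \<epsilon> * b n"] elim(2)
      unfolding u_def card by simp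
  qed
  then show "(\<lambda>n. measure (M n) {w \<in> space (M n). \<epsilon> * b n < \<bar>F n w - a n\<bar>}) \<longlonglongrightarrow> 0"
    by (intro tendsto_sandwich[OF _ _ tendsto_const u]) auto
qed

theorem theorem2:
  fixes p q :: real
    and X :: "nat \<Rightarrow> 'a set" and A :: "nat \<Rightarrow> 'b set" and \<phi> :: "nat \<Rightarrow> 'a \<Rightarrow> 'b"
    and M :: "nat \<Rightarrow> 'w measure" and Q :: "nat \<Rightarrow> nat \<Rightarrow> 'w \<Rightarrow> 'b set"
    and F :: "nat \<Rightarrow> 'w \<Rightarrow> real"
  assumes p: "1/2 \<le> p" "p < 1" and q: "q = 1 - p"
    and card: "\<And>n. card (X n) = n"
    and process: "\<And>n. renyi_process p (X n) (A n) (\<phi> n) (M n) (Q n)"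
    and F: "\<And>n w. F n w = of_int (fillup_level (X n) (\<phi> n) (\<lambda>j. Q n j w))"
  shows "(p > q \<longrightarrow> whp_eq_up_to M F
            (\<lambda>n. log (1/q) (real n) - log (1/q) (ln (ln (real n))))
            (\<lambda>n. ln (ln (ln (real n)))))
       \<and> (p = q \<longrightarrow> whp_eq_up_to M F
            (\<lambda>n. log 2 (real n) - log 2 (ln (real n)))
            (\<lambda>n. ln (ln (real n))))"
proof -
  interpret split_bias p q using p q by unfold_locales auto
  have l: "0 < ln (1/q)" by (rule ln_inv_q_pos)
  show ?thesis
  proof (intro conjI impI)
    assume "p > q"
    then show "whp_eq_up_to M F (\<lambda>n. log (1/q) (real n) - log (1/q) (ln (ln (real n))))
        (\<lambda>n. ln (ln (ln (real n))))"
    proof (intro whp_eq_up_to_fillup_level[OF process card F], unfold q[symmetric])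
      fix \<epsilon> :: real assume "0 < \<epsilon>"
      then show "\<forall>\<^sub>F n in sequentially. 0 \<le> log (1/q) (real n) - log (1/q) (ln (ln (real n))) +
          \<epsilon> * ln (ln (ln (real n)))"
        unfolding log_def using l by real_asymp
    qed (auto simp del: unrevealed.simps intro: tendsto_revealed_biased tendsto_unrevealed_biased)
  next
    assume pq: "p = q"
    then have half: "q = 1/2" using q by simp
    have two: "2 = 1/q" unfolding half by simp
    show "whp_eq_up_to M F (\<lambda>n. log 2 (real n) - log 2 (ln (real n))) (\<lambda>n. ln (ln (real n)))"
      unfolding two
    proof (intro whp_eq_up_to_fillup_level[OF process card F], unfold q[symmetric])
      fix \<epsilon> :: real assume "0 < \<epsilon>"
      then show "\<forall>\<^sub>F n in sequentially. 0 \<le> log (1/q) (real n) - log (1/q) (ln (real n)) +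
          \<epsilon> * ln (ln (real n))"
        unfolding log_def using l by real_asymp
    qed (auto simp del: unrevealed.simps intro: tendsto_revealed_unbiased tendsto_unrevealed_unbiased pq)
  qed
qed

end
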